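(* Let $d$ be a fixed positive integer. Every $n$-vertex graph $G$ with VC-dimension at most $d$ contains a clique or an independent set of size at least $e^{(\log n)^{1-o(1)}}$, where the $o(1)$ term tends to $0$ as $n\to\infty$ and may depend on $d$.
   Context: All graphs are finite and simple. For a graph $G=(V,E)$ and $v\in V$, $N(v)$ denotes the set of vertices adjacent to $v$ (so $v\notin N(v)$). The VC-dimension of a set system $\mathcal{F}$ on a ground set $V$ is the largest integer $d$ for which there is a $d$-element set $S\subset V$ such that for every $B\subset S$ there is $A\in\mathcal{F}$ with $A\cap S=B$. The VC-dimension of a graph $G$ is the VC-dimension of the set system $\{N(v): v\in V\}$ on ground set $V$. Logarithms are natural. *)

theory Defs
  imports Complex_Main "HOL-Library.Ramsey"
begin

text \<open>Cliques and independent sets are the predicates \<^const>\<open>clique\<close> and \<^const>\<open>indep\<close>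
  of the Ramsey library, for which the edges of a graph are two-element sets of vertices.\<close>

definition simple_graph :: "'a set \<Rightarrow> 'a set set \<Rightarrow> bool" where
  "simple_graph V E \<longleftrightarrow> finite V \<and> E \<subseteq> nsets V 2"

definition neighbours :: "'a set \<Rightarrow> 'a set set \<Rightarrow> 'a \<Rightarrow> 'a set" where
  "neighbours V E v = {w \<in> V. {v, w} \<in> E}"

definition shatters :: "'a set set \<Rightarrow> 'a set \<Rightarrow> bool" where
  "shatters \<F> S \<longleftrightarrow> (\<forall>B\<subseteq>S. \<exists>A\<in>\<F>. A \<inter> S = B)"

text \<open>The greatest element exists when the ground set \<open>V\<close> is finite and \<open>\<F>\<close> is nonempty
  (the empty set is then shattered); otherwise the value may be unspecified.\<close>

definition VC_dim :: "'a set \<Rightarrow> 'a set set \<Rightarrow> nat" where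
  "VC_dim V \<F> = (GREATEST d. \<exists>S\<subseteq>V. finite S \<and> card S = d \<and> shatters \<F> S)"

definition graph_VC_dim :: "'a set \<Rightarrow> 'a set set \<Rightarrow> nat" where
  "graph_VC_dim V E = VC_dim V (neighbours V E ` V)"

end

theory Submission
  imports Defs "HOL-Library.Disjoint_Sets"
begin

text \<open>A set of vertices with the same neighbourhood up to few vertices is called tight. Bounded
  VC-dimension lets us cover half of the vertices by disjoint tight pieces of equal size
  \<open>n / poly t\<close>. Averaging then gives \<open>t\<close> pieces with representatives such that between any two pieces
  almost all pairs are adjacent exactly if the representatives are. Substituting cographs found inside the
  pieces into a cograph on the representatives shows that, if \<open>F x\<close> bounds from below the logarithm of
  the largest induced cograph on \<open>exp x\<close> vertices, then \<open>F (x + C y) \<ge> F y + min (F x) y\<close>.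
  Iterating this recursion yields \<open>F x \<ge> x\<^bsup>1-o(1)\<^esup>\<close>, and a cograph on \<open>m\<close> vertices has a clique or an
  independent set of size \<open>\<surd>m\<close>.\<close>

section \<open>Sets of separated neighbourhoods\<close>

text \<open>Cliques and independent sets alone do not support the recursion: the representatives may
  yield a clique where the pieces yield independent sets. Cographs are closed under substitution
  whichever way the adjacency goes, so their sizes multiply, and a square root is lost only once, at
  the end. Bounded VC-dimension enters through a packing bound: the number of neighbourhoods that
  pairwise differ on an \<open>e\<close>-fraction of the vertices is polynomial in
  \<open>1 / e\<close>. A tight piece therefore costs only a factor polynomial in \<open>t\<close>,
  which is \<open>C y\<close> on the logarithmic scale. The obstacle is that substitution needs
  exact agreement with the representatives, whereas averaging gives agreement for almost all pairs.
  Hence atypical vertices of each piece are discarded, and then the cographs are chosen piece by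
  piece, each avoiding the vertices that disagree with those already chosen. This leaves enough room
  only if the chosen cographs have at most \<open>t\<close> vertices, which is the origin of
  \<open>min (F x) y\<close>.\<close>

lemma card_le_card_shattered:
  assumes "finite T" "F \<subseteq> Pow T"
  shows "card F \<le> card {S. S \<subseteq> T \<and> shatters F S}"
  using assms
proof (induction T arbitrary: F rule: finite_induct)
  case empty
  then consider "F = {}" | "F = {{}}" by auto
  then show ?case
  proof cases
    case 2
    then have "{S. S \<subseteq> {} \<and> shatters F S} = {{}}" by (auto simp: shatters_def)
    then show ?thesis using 2 by simp
  qed simp
next
  case (insert x T)
  \<comment> \<open>Pajor's proof of the Sauer-Shelah lemma. Stripping \<open>x\<close> can merge
    two members of \<open>F\<close>; \<open>G0 \<inter> G1\<close> counts these collisions. A set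
    shattered by \<open>G0 \<union> G1\<close> is shattered by \<open>F\<close>, and one shattered
    by \<open>G0 \<inter> G1\<close> stays shattered after \<open>x\<close> is added, so the two
    kinds of sets are told apart by \<open>x\<close>.\<close>
  define G0 where "G0 = {A \<in> F. x \<notin> A}"
  define G1 where "G1 = (\<lambda>A. A - {x}) ` {A \<in> F. x \<in> A}"
  have finF: "finite F" using insert.prems insert.hyps finite_subset by blast
  then have fin: "finite G0" "finite G1" by (auto simp: G0_def G1_def)
  have sub: "G0 \<subseteq> Pow T" "G1 \<subseteq> Pow T" using insert.prems by (auto simp: G0_def G1_def)
  let ?SF = "{S. S \<subseteq> insert x T \<and> shatters F S}"
  let ?SU = "{S. S \<subseteq> T \<and> shatters (G0 \<union> G1) S}"
  let ?SI = "{S. S \<subseteq> T \<and> shatters (G0 \<inter> G1) S}"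
  have "card G1 = card {A \<in> F. x \<in> A}"
    unfolding G1_def by (rule card_image) (auto simp: inj_on_def)
  moreover have "card F = card {A \<in> F. x \<notin> A} + card {A \<in> F. x \<in> A}"
    using finF by (subst card_Un_disjoint [symmetric]) (auto intro!: arg_cong [where f = card])
  ultimately have "card F = card G0 + card G1" by (simp add: G0_def)
  also have "\<dots> = card (G0 \<union> G1) + card (G0 \<inter> G1)" using fin by (rule card_Un_Int)
  also have "\<dots> \<le> card ?SU + card ?SI"
    using sub by (intro add_mono insert.IH) auto
  also have "card ?SI = card (insert x ` ?SI)"
    using insert.hyps by (intro card_image [symmetric]) (auto simp: inj_on_def)
  also have "card ?SU + card (insert x ` ?SI) = card (?SU \<union> insert x ` ?SI)"
    using insert.hyps by (subst card_Un_disjoint) auto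
  also have "\<dots> \<le> card ?SF"
  proof (rule card_mono)
    show "finite ?SF" using insert.hyps by simp
    have "shatters F S" if S: "S \<subseteq> T" "shatters (G0 \<union> G1) S" for S
      unfolding shatters_def
    proof (intro allI impI)
      fix B assume "B \<subseteq> S"
      then obtain A where A: "A \<in> G0 \<union> G1" "A \<inter> S = B"
        using S(2) unfolding shatters_def by meson
      moreover have "x \<notin> S" using S insert.hyps by auto
      ultimately show "\<exists>A\<in>F. A \<inter> S = B" by (auto simp: G0_def G1_def)
    qed
    moreover have "shatters F (insert x S)" if S: "S \<subseteq> T" "shatters (G0 \<inter> G1) S" for S
      unfolding shatters_def
    proof (intro allI impI)
      fix B assume B: "B \<subseteq> insert x S"
      have "B - {x} \<subseteq> S" using B by auto
      then obtain A where A: "A \<in> G0" "A \<in> G1" "A \<inter> S = B - {x}"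
        using S(2) unfolding shatters_def by (metis IntE)
      have "x \<notin> S" using S insert.hyps by auto
      have "A \<in> F" "x \<notin> A" using A by (auto simp: G0_def)
      have "insert x A \<in> F" using A(2) by (auto simp: G1_def insert_absorb)
      show "\<exists>A\<in>F. A \<inter> insert x S = B"
      proof (cases "x \<in> B")
        case True
        then have "insert x A \<inter> insert x S = B" using A by auto
        then show ?thesis using \<open>insert x A \<in> F\<close> by blast
      next
        case False
        then have "A \<inter> insert x S = B" using A \<open>x \<notin> A\<close> by auto
        then show ?thesis using \<open>A \<in> F\<close> by blast
      qed
    qed
    ultimately show "?SU \<union> insert x ` ?SI \<subseteq> ?SF" by auto
  qed
  finally show ?case by simp
qed

text \<open>A small subset is the content of a list of length \<open>d\<close> over \<open>T\<close>
  and a blank \<open>None\<close>, the blank padding sets with fewer than \<open>d\<close>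
  elements.\<close>

lemma card_small_subsets_le:
  assumes "finite T"
  shows "card {S. S \<subseteq> T \<and> card S \<le> d} \<le> (card T + 1) ^ d"
proof -
  let ?L = "{xs. set xs \<subseteq> insert None (Some ` T) \<and> length xs = d}"
  have "S \<in> (\<lambda>xs. {x. Some x \<in> set xs}) ` ?L" if S: "S \<subseteq> T" "card S \<le> d" for S
  proof -
    obtain ys where ys: "set ys = S" "distinct ys"
      using S assms finite_distinct_list finite_subset by metis
    then have "length ys \<le> d" using S distinct_card by fastforce
    then show ?thesis using ys S
      by (intro image_eqI [of _ _ "map Some ys @ replicate (d - length ys) None"]) auto
  qed
  then have "card {S. S \<subseteq> T \<and> card S \<le> d} \<le> card ?L"
    using assms finite_lists_length_eq [of "insert None (Some ` T)" d]
    by (intro surj_card_le [where f = "\<lambda>xs. {x. Some x \<in> set xs}"]) auto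
  also have "\<dots> = (card T + 1) ^ d"
    using assms by (subst card_lists_length_eq) (simp_all add: card_insert_if card_image)
  finally show ?thesis .
qed

text \<open>An upper bound in place of a greatest element: it speaks of an adjacency relation cut
  down to \<open>V\<close> and passes to subsets of \<open>V\<close>.\<close>

definition vc_le :: "nat \<Rightarrow> ('a \<Rightarrow> 'a \<Rightarrow> bool) \<Rightarrow> 'a set \<Rightarrow> bool" where
  "vc_le d A V \<longleftrightarrow> (\<forall>S\<subseteq>V. shatters ((\<lambda>v. {w \<in> V. A v w}) ` V) S \<longrightarrow> card S \<le> d)"

lemma vc_le_subset:
  assumes "vc_le d A V" "V' \<subseteq> V"
  shows "vc_le d A V'"
  unfolding vc_le_def
proof (intro allI impI)
  fix S assume S: "S \<subseteq> V'" "shatters ((\<lambda>v. {w \<in> V'. A v w}) ` V') S"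
  have eq: "{w \<in> V'. A v w} \<inter> S = {w \<in> V. A v w} \<inter> S" for v using S assms by auto
  have "shatters ((\<lambda>v. {w \<in> V. A v w}) ` V) S"
    using S(2) assms(2) unfolding shatters_def eq bex_simps by (meson subsetD)
  then show "card S \<le> d" using assms S unfolding vc_le_def by blast
qed

text \<open>The Sauer-Shelah bound for traces: a subset of \<open>T\<close> shattered by traces on
  \<open>T\<close> is shattered by the full neighbourhoods, so it has at most \<open>d\<close>
  elements.\<close>

lemma card_le_distinct_traces:
  assumes "vc_le d A V" "finite V" "T \<subseteq> V" "Y \<subseteq> V"
    and inj: "inj_on (\<lambda>v. {w \<in> T. A v w}) Y"
  shows "card Y \<le> (card T + 1) ^ d"
proof -
  let ?F = "(\<lambda>v. {w \<in> T. A v w}) ` Y"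
  have finT: "finite T" using assms finite_subset by blast
  have "card S \<le> d" if S: "S \<subseteq> T" "shatters ?F S" for S
  proof -
    have eq: "{w \<in> T. A v w} \<inter> S = {w \<in> V. A v w} \<inter> S" for v using S assms by auto
    have "shatters ((\<lambda>v. {w \<in> V. A v w}) ` V) S"
      using S(2) assms(4) unfolding shatters_def eq bex_simps by (meson subsetD)
    then show ?thesis using S assms unfolding vc_le_def by (meson subset_trans)
  qed
  then have sub: "{S. S \<subseteq> T \<and> shatters ?F S} \<subseteq> {S. S \<subseteq> T \<and> card S \<le> d}" by auto
  have "card Y = card ?F" using inj by (simp add: card_image)
  also have "\<dots> \<le> card {S. S \<subseteq> T \<and> shatters ?F S}"
    by (rule card_le_card_shattered) (use finT in auto)
  also have "\<dots> \<le> card {S. S \<subseteq> T \<and> card S \<le> d}"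
    using finT sub by (intro card_mono) auto
  also have "\<dots> \<le> (card T + 1) ^ d" using finT by (rule card_small_subsets_le)
  finally show ?thesis .
qed

text \<open>Greedy choice: by double counting, some vertex lies in at least a fraction
  \<open>e\<close> of the sets \<open>D p\<close> not yet hit, so each new vertex shrinks their
  number by the factor \<open>1 - e\<close>.\<close>

lemma hitting_set:
  fixes D :: "'b \<Rightarrow> 'a set" and e :: real
  assumes V: "finite V" "V \<noteq> {}" and P: "finite P"
    and D: "\<And>p. p \<in> P \<Longrightarrow> D p \<subseteq> V \<and> e * card V \<le> card (D p)"
    and e: "e \<le> 1"
  shows "\<exists>T\<subseteq>V. card T \<le> m \<and> card {p \<in> P. D p \<inter> T = {}} \<le> (1 - e) ^ m * card P"
proof (induction m)
  case 0
  show ?case by (rule exI [of _ "{}"]) simp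
next
  case (Suc m)
  then obtain T where T: "T \<subseteq> V" "card T \<le> m"
    and Tm: "card {p \<in> P. D p \<inter> T = {}} \<le> (1 - e) ^ m * card P" by blast
  define Q where "Q = {p \<in> P. D p \<inter> T = {}}"
  have finQ: "finite Q" using P by (simp add: Q_def)
  have "\<exists>w\<in>V. e * card Q \<le> card {p \<in> Q. w \<in> D p}"
  proof (rule ccontr)
    assume "\<not> ?thesis"
    then have less: "\<And>w. w \<in> V \<Longrightarrow> card {p \<in> Q. w \<in> D p} < e * card Q" by force
    have "(\<Sum>w\<in>V. real (card {p \<in> Q. w \<in> D p})) = (\<Sum>w\<in>V. \<Sum>p | p \<in> Q \<and> w \<in> D p. 1)"
      by simp
    also have "\<dots> = (\<Sum>p\<in>Q. \<Sum>w | w \<in> V \<and> w \<in> D p. 1)"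
      using V finQ by (intro sum.swap_restrict) auto
    also have "\<dots> = (\<Sum>p\<in>Q. real (card (D p)))"
    proof (rule sum.cong)
      fix p assume "p \<in> Q"
      then have "{w. w \<in> V \<and> w \<in> D p} = D p" using D by (auto simp: Q_def)
      then show "(\<Sum>w | w \<in> V \<and> w \<in> D p. 1) = real (card (D p))" by simp
    qed simp
    also have "\<dots> \<ge> (\<Sum>p\<in>Q. e * card V)" using D by (intro sum_mono) (auto simp: Q_def)
    also have "(\<Sum>p\<in>Q. e * card V) = (\<Sum>w\<in>V. e * card Q)" by simp
    finally have "(\<Sum>w\<in>V. e * card Q) \<le> (\<Sum>w\<in>V. real (card {p \<in> Q. w \<in> D p}))" .
    moreover have "(\<Sum>w\<in>V. real (card {p \<in> Q. w \<in> D p})) < (\<Sum>w\<in>V. e * card Q)"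
      using V less by (intro sum_strict_mono) auto
    ultimately show False by linarith
  qed
  then obtain w where w: "w \<in> V" "e * card Q \<le> card {p \<in> Q. w \<in> D p}" by blast
  have "{p \<in> P. D p \<inter> insert w T = {}} = Q - {p \<in> Q. w \<in> D p}" by (auto simp: Q_def)
  then have "real (card {p \<in> P. D p \<inter> insert w T = {}}) = card Q - real (card {p \<in> Q. w \<in> D p})"
    using finQ by (simp add: card_Diff_subset card_mono of_nat_diff)
  also have "\<dots> \<le> (1 - e) * card Q" using w by (simp add: algebra_simps)
  also have "\<dots> \<le> (1 - e) * ((1 - e) ^ m * card P)"
    using Tm e by (intro mult_left_mono) (auto simp: Q_def)
  finally have "card {p \<in> P. D p \<inter> insert w T = {}} \<le> (1 - e) ^ Suc m * card P" by simp
  moreover have "card (insert w T) \<le> Suc m"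
    using T(2) card_insert_le_m1 [of "Suc m" T w] by simp
  ultimately show ?case using T w by (intro exI [of _ "insert w T"]) auto
qed

text \<open>Its cardinality is the Hamming distance of the two neighbourhoods within
  \<open>V\<close>.\<close>

definition differ :: "('a \<Rightarrow> 'a \<Rightarrow> bool) \<Rightarrow> 'a set \<Rightarrow> 'a \<Rightarrow> 'a \<Rightarrow> 'a set" where
  "differ A V u v = {w \<in> V. A u w \<noteq> A v w}"

text \<open>A packing bound of Haussler type, with exponent \<open>2 * d\<close>. A set
  \<open>T\<close> of about \<open>2 * ln y / e\<close> vertices separates all \<open>y\<close>
  members of \<open>Y\<close>, so their traces on \<open>T\<close> are distinct and \<open>y\<close>
  is at most about \<open>(ln y / e) ^ d\<close>. Solving this for \<open>y\<close> costs the
  doubled exponent.\<close>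

lemma separated_card_le:
  fixes e :: real
  assumes vc: "vc_le d A V" and d: "d > 0" and V: "finite V"
    and Y: "Y \<subseteq> V" and e: "0 < e" "e \<le> 1"
    and sep: "\<And>u v. u \<in> Y \<Longrightarrow> v \<in> Y \<Longrightarrow> u \<noteq> v \<Longrightarrow> e * card V < card (differ A V u v)"
  shows "card Y \<le> ((4 * d + 3) / e) ^ (2 * d)"
proof (cases "Y = {}")
  case True
  then show ?thesis using e by simp
next
  case False
  have finY: "finite Y" using Y V finite_subset by blast
  define y where "y = real (card Y)"
  have y1: "y \<ge> 1" using False finY by (simp add: y_def Suc_le_eq card_gt_0_iff)
  define P where "P = {(u, v). u \<in> Y \<and> v \<in> Y \<and> u \<noteq> v}"
  have PY: "P \<subseteq> Y \<times> Y" by (auto simp: P_def)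
  have finP: "finite P" using PY finY finite_subset by blast
  have "card P \<le> card (Y \<times> Y)" using PY finY by (intro card_mono) auto
  then have "real (card P) \<le> real (card Y * card Y)" by (simp only: card_cartesian_product of_nat_le_iff)
  then have cardP: "card P \<le> y\<^sup>2" by (simp add: y_def power2_eq_square)
  define m where "m = nat \<lfloor>2 * ln y / e\<rfloor> + 1"
  have lny: "ln y \<ge> 0" using y1 by simp
  have m1: "2 * ln y < e * m"
  proof -
    \<comment> \<open>\<open>m\<close> is large enough for
      \<open>(1 - e) ^ m * y\<^sup>2 < 1\<close>: the number of pairs left unseparated is then an
      integer below 1, hence 0.\<close>
    have "2 * ln y / e < m" using lny e by (simp add: m_def) linarith
    then show ?thesis using e by (simp add: field_simps)
  qed
  have m2: "m + 1 \<le> 2 * ln y / e + 2" using lny e by (simp add: m_def)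
  have "\<exists>T\<subseteq>V. card T \<le> m \<and> card {p \<in> P. (case p of (u, v) \<Rightarrow> differ A V u v) \<inter> T = {}} \<le> (1 - e) ^ m * card P"
  proof (rule hitting_set)
    show "V \<noteq> {}" using False Y by auto
    fix p assume "p \<in> P"
    then show "(case p of (u, v) \<Rightarrow> differ A V u v) \<subseteq> V \<and>
        e * card V \<le> card (case p of (u, v) \<Rightarrow> differ A V u v)"
      using sep by (auto simp: P_def differ_def less_imp_le)
  qed (use V finP e in auto)
  then obtain T where T: "T \<subseteq> V" "card T \<le> m"
    and Tm: "card {p \<in> P. (case p of (u, v) \<Rightarrow> differ A V u v) \<inter> T = {}} \<le> (1 - e) ^ m * card P"
    (is "real (card ?Q) \<le> _") by blast
  have "(1 - e) ^ m * card P \<le> exp (- e) ^ m * y\<^sup>2"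
    using e cardP exp_ge_add_one_self [of "- e"] by (intro mult_mono power_mono) auto
  also have "exp (- e) ^ m = exp (- (e * m))" by (simp add: mult.commute flip: exp_of_nat_mult)
  also have "y\<^sup>2 = exp (2 * ln y)" using y1 by (simp add: exp_double)
  also have "exp (- (e * m)) * exp (2 * ln y) = exp (2 * ln y - e * m)" by (simp flip: exp_add)
  also have "\<dots> < 1" using m1 by simp
  finally have "card ?Q = 0" using Tm by simp
  then have Q0: "?Q = {}" using finP by simp
  have "inj_on (\<lambda>v. {w \<in> T. A v w}) Y"
  proof (rule inj_onI, rule ccontr)
    fix u v assume uv: "u \<in> Y" "v \<in> Y" "{w \<in> T. A u w} = {w \<in> T. A v w}" "u \<noteq> v"
    then have "(u, v) \<notin> ?Q" "(u, v) \<in> P" using Q0 by (auto simp: P_def)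
    then have "differ A V u v \<inter> T \<noteq> {}" by auto
    then show False using uv by (auto simp: differ_def)
  qed
  then have "card Y \<le> (card T + 1) ^ d"
    using card_le_distinct_traces [OF vc V T(1) Y] by blast
  also have "\<dots> \<le> (m + 1) ^ d" using T by (intro power_mono) auto
  finally have "y \<le> (real m + 1) ^ d" unfolding y_def by (metis of_nat_1 of_nat_add of_nat_le_iff of_nat_power)
  \<comment> \<open>The logarithm is absorbed by a small power:
    \<open>ln y = 2 * d * ln r \<le> 2 * d * r\<close>. The bound then contains
    \<open>r ^ d\<close>, the square root of \<open>y\<close>, which cancels against one half of
    \<open>y = r ^ d * r ^ d\<close>.\<close>
  define r where "r = y powr (1 / (2 * d))"
  have r1: "r \<ge> 1" using y1 by (simp add: r_def ge_one_powr_ge_zero)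
  have rd: "r ^ (2 * d) = y" using d y1 by (simp add: r_def powr_power)
  have "ln y / (2 * d) = ln r" using y1 by (simp add: r_def ln_powr)
  also have "\<dots> \<le> r" using r1 ln_le_minus_one [of r] by simp
  finally have lnr: "ln y \<le> 2 * d * r" using d by (simp add: field_simps)
  have "real m + 1 \<le> 2 * ln y / e + 2" using m2 by simp
  also have "\<dots> \<le> 2 * (2 * d * r) / e + 3 * r / e"
  proof (intro add_mono divide_right_mono mult_left_mono lnr)
    have "e * 2 \<le> 1 * (3 * r)" using e r1 by (intro mult_mono) auto
    then show "2 \<le> 3 * r / e" using e by (simp add: field_simps)
  qed (use e in auto)
  also have "\<dots> = (4 * d + 3) / e * r" by (simp add: add_divide_distrib algebra_simps)
  finally have "(real m + 1) ^ d \<le> ((4 * d + 3) / e * r) ^ d" by (intro power_mono) auto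
  then have "y \<le> ((4 * d + 3) / e) ^ d * r ^ d"
    using \<open>y \<le> (real m + 1) ^ d\<close> unfolding power_mult_distrib by linarith
  then have "r ^ d * r ^ d \<le> ((4 * d + 3) / e) ^ d * r ^ d"
    using rd by (simp add: mult_2 power_add)
  then have "r ^ d \<le> ((4 * d + 3) / e) ^ d" using r1 by (simp add: mult_le_cancel_right)
  then have "(r ^ d)\<^sup>2 \<le> (((4 * d + 3) / e) ^ d)\<^sup>2" using r1 by (intro power_mono [of "r ^ d"]) auto
  moreover have "(z ^ d)\<^sup>2 = z ^ (2 * d)" for z :: real by (simp add: power_even_eq)
  ultimately show ?thesis using rd by (simp add: y_def)
qed

section \<open>Cographs\<close>

text \<open>The value \<open>b\<close> makes a step a disjoint union or a join. Only pairs from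
  \<open>X\<close> to \<open>Y\<close> are constrained; symmetry of \<open>A\<close> is assumed
  where the other direction matters.\<close>

inductive cograph :: "('a \<Rightarrow> 'a \<Rightarrow> bool) \<Rightarrow> 'a set \<Rightarrow> bool" for A where
  empty: "cograph A {}"
| singleton: "cograph A {v}"
| union: "cograph A X \<Longrightarrow> cograph A Y \<Longrightarrow> X \<inter> Y = {} \<Longrightarrow> (\<forall>x\<in>X. \<forall>y\<in>Y. A x y = b) \<Longrightarrow> cograph A (X \<union> Y)"

lemma cograph_finite: "cograph A X \<Longrightarrow> finite X"
  by (induction rule: cograph.induct) auto

lemma cograph_subset:
  assumes "cograph A X" "Y \<subseteq> X"
  shows "cograph A Y"
  using assms
proof (induction arbitrary: Y rule: cograph.induct)
  case (singleton v)
  then have "Y = {} \<or> Y = {v}" by auto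
  then show ?case by (auto intro: cograph.intros)
next
  case (union X1 X2 b)
  have "cograph A ((Y \<inter> X1) \<union> (Y \<inter> X2))"
    by (rule cograph.union [where b = b]) (use union in auto)
  moreover have "(Y \<inter> X1) \<union> (Y \<inter> X2) = Y" using union.prems by auto
  ultimately show ?case by simp
qed (auto intro: cograph.intros)

text \<open>The construction of \<open>X\<close> is replayed on the sets \<open>U i\<close>: a step
  joining disjoint index sets with value \<open>b\<close> becomes a step joining the corresponding
  unions with the same \<open>b\<close>.\<close>

lemma cograph_substitution:
  assumes "cograph A X"
    and "\<And>i. i \<in> X \<Longrightarrow> cograph A (U i)"
    and "disjoint_family_on U X"
    and "\<And>i j u z. i \<in> X \<Longrightarrow> j \<in> X \<Longrightarrow> i \<noteq> j \<Longrightarrow> u \<in> U i \<Longrightarrow> z \<in> U j \<Longrightarrow> A u z = A i j"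
  shows "cograph A (\<Union>i\<in>X. U i)"
  using assms
proof (induction rule: cograph.induct)
  case (union X Y b)
  have "cograph A ((\<Union>i\<in>X. U i) \<union> (\<Union>i\<in>Y. U i))"
  proof (rule cograph.union [where b = b])
    show "cograph A (\<Union>i\<in>X. U i)"
      using union.prems by (intro union.IH(1)) (auto simp: disjoint_family_on_def)
    show "cograph A (\<Union>i\<in>Y. U i)"
      using union.prems by (intro union.IH(2)) (auto simp: disjoint_family_on_def)
    show "(\<Union>i\<in>X. U i) \<inter> (\<Union>i\<in>Y. U i) = {}"
    proof (rule ccontr)
      assume "\<not> ?thesis"
      then obtain i j v where "i \<in> X" "j \<in> Y" "v \<in> U i" "v \<in> U j" by auto
      then show False
        using union.hyps(3) disjoint_family_onD [OF union.prems(2), of i j] by auto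
    qed
    have "A u z = b" if "i \<in> X" "u \<in> U i" "j \<in> Y" "z \<in> U j" for i u j z
    proof -
      have "i \<noteq> j" "A i j = b" using union.hyps(3,4) that by auto
      then show ?thesis using union.prems(3) [of i j u z] that by simp
    qed
    then show "\<forall>x\<in>\<Union>i\<in>X. U i. \<forall>y\<in>\<Union>i\<in>Y. U i. A x y = b" by blast
  qed
  then show ?case by (simp add: UN_Un)
qed (auto intro: cograph.intros)

text \<open>Cographs are perfect; this is the product form of that fact.\<close>

lemma cograph_homogeneous_product:
  assumes "cograph A U" and sym: "symp A"
  shows "\<exists>X Y. X \<subseteq> U \<and> Y \<subseteq> U \<and> (\<forall>u\<in>X. \<forall>v\<in>X. u \<noteq> v \<longrightarrow> A u v) \<and>
    (\<forall>u\<in>Y. \<forall>v\<in>Y. u \<noteq> v \<longrightarrow> \<not> A u v) \<and> card U \<le> card X * card Y"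
  using assms(1)
proof (induction rule: cograph.induct)
  case empty
  show ?case by (intro exI [of _ "{}"]) simp
next
  case (singleton v)
  show ?case by (intro exI [of _ "{v}"]) simp
next
  case (union U1 U2 b)
  obtain X1 Y1 where 1: "X1 \<subseteq> U1" "Y1 \<subseteq> U1" "\<forall>u\<in>X1. \<forall>v\<in>X1. u \<noteq> v \<longrightarrow> A u v"
    "\<forall>u\<in>Y1. \<forall>v\<in>Y1. u \<noteq> v \<longrightarrow> \<not> A u v" "card U1 \<le> card X1 * card Y1" using union.IH(1) by blast
  obtain X2 Y2 where 2: "X2 \<subseteq> U2" "Y2 \<subseteq> U2" "\<forall>u\<in>X2. \<forall>v\<in>X2. u \<noteq> v \<longrightarrow> A u v"
    "\<forall>u\<in>Y2. \<forall>v\<in>Y2. u \<noteq> v \<longrightarrow> \<not> A u v" "card U2 \<le> card X2 * card Y2" using union.IH(2) by blast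
  have fin: "finite U1" "finite U2" using union.hyps(1,2) cograph_finite by blast+
  have cardU: "card (U1 \<union> U2) = card U1 + card U2" using fin union.hyps by (intro card_Un_disjoint)
  have cross: "A u v = b" "A v u = b" if "u \<in> U1" "v \<in> U2" for u v
    using union.hyps(4) that sympD [OF sym] by auto
  show ?case
  proof (cases b)
    case True
    \<comment> \<open>In a join the cliques unite and the larger independent set is kept, so both
      products are bounded using the same second factor. The disjoint union below is the
      complementary case.\<close>
    define Y where "Y = (if card Y1 \<le> card Y2 then Y2 else Y1)"
    have le: "card Y1 \<le> card Y" "card Y2 \<le> card Y" by (auto simp: Y_def)
    have "card (X1 \<union> X2) = card X1 + card X2"
      using 1(1) 2(1) fin union.hyps(3) by (intro card_Un_disjoint) (auto intro: finite_subset)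
    then have "card (U1 \<union> U2) \<le> card (X1 \<union> X2) * card Y"
      unfolding cardU using le
        add_mono [OF order_trans [OF 1(5) mult_le_mono2] order_trans [OF 2(5) mult_le_mono2]]
      by (simp add: add_mult_distrib)
    moreover have "\<forall>u\<in>X1 \<union> X2. \<forall>v\<in>X1 \<union> X2. u \<noteq> v \<longrightarrow> A u v"
      using 1(3) 2(3) cross True subsetD [OF 1(1)] subsetD [OF 2(1)] by (elim UnE | intro ballI impI | simp)+
    ultimately show ?thesis using 1 2
      by (intro exI [of _ "X1 \<union> X2"] exI [of _ Y]) (auto simp: Y_def)
  next
    case False
    define X where "X = (if card X1 \<le> card X2 then X2 else X1)"
    have le: "card X1 \<le> card X" "card X2 \<le> card X" by (auto simp: X_def)
    have "card (Y1 \<union> Y2) = card Y1 + card Y2"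
      using 1(2) 2(2) fin union.hyps(3) by (intro card_Un_disjoint) (auto intro: finite_subset)
    then have "card (U1 \<union> U2) \<le> card X * card (Y1 \<union> Y2)"
      unfolding cardU using le
        add_mono [OF order_trans [OF 1(5) mult_le_mono1] order_trans [OF 2(5) mult_le_mono1]]
      by (simp add: add_mult_distrib2)
    moreover have "\<forall>u\<in>Y1 \<union> Y2. \<forall>v\<in>Y1 \<union> Y2. u \<noteq> v \<longrightarrow> \<not> A u v"
      using 1(4) 2(4) cross False subsetD [OF 1(2)] subsetD [OF 2(2)] by (elim UnE | intro ballI impI | simp)+
    ultimately show ?thesis using 1 2
      by (intro exI [of _ X] exI [of _ "Y1 \<union> Y2"]) (auto simp: X_def)
  qed
qed

section \<open>Tight pieces\<close>

text \<open>Pieces are removed one at a time while at least \<open>L\<close> vertices remain;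
  \<open>s > 0\<close> makes every removal proper.\<close>

lemma disjoint_pieces:
  fixes L :: real
  assumes "finite R" "s > 0"
    and "\<And>R'. R' \<subseteq> R \<Longrightarrow> L \<le> real (card R') \<Longrightarrow> \<exists>W\<subseteq>R'. card W = s \<and> Q W"
  shows "\<exists>\<W>. disjoint \<W> \<and> \<Union>\<W> \<subseteq> R \<and> (\<forall>W\<in>\<W>. card W = s \<and> Q W) \<and> card (R - \<Union>\<W>) \<le> L"
  using assms(1,3)
proof (induction rule: finite_psubset_induct)
  case (psubset R)
  show ?case
  proof (cases "L \<le> card R")
    case False
    then show ?thesis by (intro exI [of _ "{}"]) simp
  next
    case True
    then obtain W where W: "W \<subseteq> R" "card W = s" "Q W" using psubset.prems [of R] by auto
    have "W \<noteq> {}" using W assms(2) by auto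
    then have "R - W \<subset> R" using W by blast
    then obtain \<W> where \<W>: "disjoint \<W>" "\<Union>\<W> \<subseteq> R - W" "\<forall>W\<in>\<W>. card W = s \<and> Q W"
      "card (R - W - \<Union>\<W>) \<le> L"
    proof -
      have "\<exists>\<W>. disjoint \<W> \<and> \<Union>\<W> \<subseteq> R - W \<and> (\<forall>W\<in>\<W>. card W = s \<and> Q W) \<and> card (R - W - \<Union>\<W>) \<le> L"
        using psubset.prems by (intro psubset.IH [OF \<open>R - W \<subset> R\<close>]) (meson Diff_subset order_trans)
      then show thesis using that by blast
    qed
    have "R - \<Union>(insert W \<W>) = R - W - \<Union>\<W>" by auto
    moreover have "disjoint (insert W \<W>)" using \<W> by (auto simp: pairwise_insert disjnt_def)
    ultimately show ?thesis using W \<W> by (intro exI [of _ "insert W \<W>"]) auto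
  qed
qed

lemma card_differ_triangle:
  assumes "finite V"
  shows "card (differ A V u w) \<le> card (differ A V v u) + card (differ A V v w)"
proof -
  have "differ A V u w \<subseteq> differ A V v u \<union> differ A V v w" by (auto simp: differ_def)
  moreover have "finite (differ A V v u \<union> differ A V v w)" using assms by (auto simp: differ_def)
  ultimately have "card (differ A V u w) \<le> card (differ A V v u \<union> differ A V v w)" by (intro card_mono)
  also have "\<dots> \<le> card (differ A V v u) + card (differ A V v w)" by (rule card_Un_le)
  finally show ?thesis .
qed

lemma maximal_subset_exists:
  assumes "finite R" "Q {}"
  obtains Y where "Y \<subseteq> R" "Q Y" "\<And>Z. Z \<subseteq> R \<Longrightarrow> Q Z \<Longrightarrow> Y \<subseteq> Z \<Longrightarrow> Z = Y"
proof -
  let ?F = "{Y. Y \<subseteq> R \<and> Q Y}"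
  have "\<exists>Y\<in>?F. \<forall>Z\<in>?F. Y \<subseteq> Z \<longrightarrow> Y = Z"
    by (rule finite_has_maximal) (use assms in auto)
  then obtain Y where Y: "Y \<in> ?F" "\<forall>Z\<in>?F. Y \<subseteq> Z \<longrightarrow> Y = Z" by (rule bexE)
  show thesis
  proof (rule that)
    show "Y \<subseteq> R" "Q Y" using Y(1) by simp_all
    show "Z = Y" if "Z \<subseteq> R" "Q Z" "Y \<subseteq> Z" for Z using Y(2) that by blast
  qed
qed

text \<open>By maximality, the balls of radius \<open>e / 2\<close> around a maximal
  \<open>e / 2\<close>-separated subset of \<open>R\<close> cover \<open>R\<close>. The packing
  bound limits their number, so one of them has at least \<open>s\<close> elements, and the triangle
  inequality makes it tight. The constant \<open>8 * d + 6\<close> is \<open>4 * d + 3\<close>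
  divided by the \<open>1 / 2\<close> in the radius.\<close>

lemma tight_subset_exists:
  fixes e :: real
  assumes vc: "vc_le d A V" and d: "d > 0" and V: "finite V" and e: "0 < e" "e \<le> 1"
    and R: "R \<subseteq> V" and card: "((8 * real d + 6) / e) ^ (2 * d) * s \<le> card R" and s: "s > 0"
  shows "\<exists>W\<subseteq>R. card W = s \<and> (\<forall>u\<in>W. \<forall>v\<in>W. card (differ A V u v) \<le> e * card V)"
proof -
  define sep where "sep Y \<longleftrightarrow> (\<forall>u\<in>Y. \<forall>v\<in>Y. u \<noteq> v \<longrightarrow> e / 2 * card V < card (differ A V u v))" for Y
  have finR: "finite R" using R V finite_subset by blast
  obtain Y where Y: "Y \<subseteq> R" "sep Y" and max: "\<And>Z. Z \<subseteq> R \<Longrightarrow> sep Z \<Longrightarrow> Y \<subseteq> Z \<Longrightarrow> Z = Y"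
    by (rule maximal_subset_exists [OF finR, of sep]) (auto simp: sep_def)
  have finY: "finite Y" using Y finR finite_subset by blast
  have "card Y \<le> ((4 * real d + 3) / (e / 2)) ^ (2 * d)"
    by (rule separated_card_le [OF vc d V]) (use Y R e in \<open>auto simp: sep_def\<close>)
  also have "(4 * real d + 3) / (e / 2) = (8 * real d + 6) / e" by simp
  finally have cardY: "card Y \<le> ((8 * real d + 6) / e) ^ (2 * d)" by simp
  define B where "B y = {u \<in> R. card (differ A V y u) \<le> e / 2 * card V}" for y
  have self: "differ A V u u = {}" for u by (simp add: differ_def)
  have comm: "differ A V u v = differ A V v u" for u v by (auto simp: differ_def)
  have cover: "R \<subseteq> (\<Union>y\<in>Y. B y)"
  proof
    fix u assume u: "u \<in> R"
    show "u \<in> (\<Union>y\<in>Y. B y)"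
    proof (cases "u \<in> Y")
      case True
      moreover have "u \<in> B u" using u e by (simp add: B_def self)
      ultimately show ?thesis by blast
    next
      case False
      then have "\<not> sep (insert u Y)" using max [of "insert u Y"] Y(1) u by blast
      then obtain y where "y \<in> Y" "card (differ A V y u) \<le> e / 2 * card V"
        using Y(2) comm unfolding sep_def by (metis insert_iff not_less)
      then show ?thesis using u by (auto simp: B_def)
    qed
  qed
  have "\<exists>y\<in>Y. s \<le> card (B y)"
  proof (rule ccontr)
    assume "\<not> ?thesis"
    then have less: "\<And>y. y \<in> Y \<Longrightarrow> card (B y) < s" by force
    have "0 < ((8 * real d + 6) / e) ^ (2 * d) * s" using e s by simp
    then have "R \<noteq> {}" using card by auto
    then have "Y \<noteq> {}" using cover by auto
    have "card R \<le> card (\<Union>y\<in>Y. B y)" using cover finY finR by (intro card_mono) (auto simp: B_def)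
    also have "\<dots> \<le> (\<Sum>y\<in>Y. card (B y))" using finY by (rule card_UN_le)
    also have "\<dots> < (\<Sum>y\<in>Y. s)" using finY \<open>Y \<noteq> {}\<close> less by (intro sum_strict_mono) auto
    finally have "card R < card Y * s" by simp
    then have "real (card R) < real (card Y) * s" by (metis of_nat_less_iff of_nat_mult)
    also have "\<dots> \<le> ((8 * real d + 6) / e) ^ (2 * d) * s" using cardY by (intro mult_right_mono) auto
    finally show False using card by simp
  qed
  then obtain y where y: "y \<in> Y" "s \<le> card (B y)" by blast
  then obtain W where W: "W \<subseteq> B y" "card W = s" by (meson obtain_subset_with_card_n)
  have "card (differ A V u v) \<le> e * card V" if "u \<in> W" "v \<in> W" for u v
  proof -
    have "real (card (differ A V u v)) \<le> real (card (differ A V y u)) + card (differ A V y v)"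
      using card_differ_triangle [OF V, of A u v y] by simp
    also have "\<dots> \<le> e / 2 * card V + e / 2 * card V"
      using that W by (intro add_mono) (auto simp: B_def)
    finally show ?thesis by simp
  qed
  then show ?thesis using W by (intro exI [of _ W]) (auto simp: B_def)
qed

text \<open>The sets are chosen one index at a time. At most \<open>card X * q\<close> vertices have
  been chosen before, each spoiling at most \<open>b\<close> vertices of the next
  \<open>W i\<close>, so at least \<open>L\<close> candidates remain there and \<open>Q\<close> can
  be met among them. The symmetry of \<open>G\<close> lets each new set be checked against the
  earlier ones in one direction only.\<close>

lemma greedy_transversal:
  fixes W :: "'a \<Rightarrow> 'a set" and b L s :: real
  assumes X: "finite X" and card: "real (card X) * q * b + L \<le> s"
    and W: "\<And>i. i \<in> X \<Longrightarrow> finite (W i) \<and> s \<le> card (W i)"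
    and few: "\<And>i j u. i \<in> X \<Longrightarrow> j \<in> X \<Longrightarrow> i \<noteq> j \<Longrightarrow> u \<in> W i \<Longrightarrow> card {z \<in> W j. \<not> G i j u z} \<le> b"
    and b: "b \<ge> 0"
    and G: "\<And>i j u z. G i j u z \<Longrightarrow> G j i z u"
    and Q: "\<And>i S. i \<in> X \<Longrightarrow> S \<subseteq> W i \<Longrightarrow> L \<le> card S \<Longrightarrow> \<exists>U\<subseteq>S. card U = q \<and> Q U"
    and q: "q > 0"
  shows "\<exists>U. (\<forall>i\<in>X. U i \<subseteq> W i \<and> card (U i) = q \<and> Q (U i)) \<and>
    (\<forall>i\<in>X. \<forall>j\<in>X. i \<noteq> j \<longrightarrow> (\<forall>u\<in>U i. \<forall>z\<in>U j. G i j u z))"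
  using X card W few Q
proof (induction rule: finite_induct)
  case empty
  show ?case by simp
next
  case (insert x X)
  have "real (card X) * q * b \<le> real (card (insert x X)) * q * b"
    using insert.hyps b by (intro mult_right_mono) auto
  then have le: "real (card X) * q * b + L \<le> s" using insert.prems(1) by linarith
  have "\<exists>U. (\<forall>i\<in>X. U i \<subseteq> W i \<and> card (U i) = q \<and> Q (U i)) \<and>
    (\<forall>i\<in>X. \<forall>j\<in>X. i \<noteq> j \<longrightarrow> (\<forall>u\<in>U i. \<forall>z\<in>U j. G i j u z))"
  proof (rule insert.IH [OF le])
    show "finite (W i) \<and> s \<le> card (W i)" if "i \<in> X" for i
      using insert.prems(2) that by simp
    show "card {z \<in> W j. \<not> G i j u z} \<le> b" if "i \<in> X" "j \<in> X" "i \<noteq> j" "u \<in> W i" for i j u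
      using insert.prems(3) that by simp
    show "\<exists>U\<subseteq>S. card U = q \<and> Q U" if "i \<in> X" "S \<subseteq> W i" "L \<le> card S" for i S
      by (rule insert.prems(4)) (use that in auto)
  qed
  then obtain U where U': "\<forall>i\<in>X. U i \<subseteq> W i \<and> card (U i) = q \<and> Q (U i)"
    and UG: "\<forall>i\<in>X. \<forall>j\<in>X. i \<noteq> j \<longrightarrow> (\<forall>u\<in>U i. \<forall>z\<in>U j. G i j u z)" by (elim exE conjE)
  have U: "U i \<subseteq> W i" "card (U i) = q" "Q (U i)" if "i \<in> X" for i using U' that by auto
  define D where "D = (\<Union>i\<in>X. \<Union>u\<in>U i. {z \<in> W x. \<not> G i x u z})"
  have finW: "finite (W x)" using insert.prems(2) by blast
  have finU: "finite (U i)" if "i \<in> X" for i by (rule card_ge_0_finite) (use U(2) [OF that] q in simp)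
  have DW: "D \<subseteq> W x" by (auto simp: D_def)
  have "card D \<le> (\<Sum>i\<in>X. card (\<Union>u\<in>U i. {z \<in> W x. \<not> G i x u z}))"
    unfolding D_def using insert.hyps by (intro card_UN_le)
  also have "\<dots> \<le> (\<Sum>i\<in>X. \<Sum>u\<in>U i. card {z \<in> W x. \<not> G i x u z})"
    using finU by (intro sum_mono card_UN_le)
  finally have "real (card D) \<le> (\<Sum>i\<in>X. \<Sum>u\<in>U i. real (card {z \<in> W x. \<not> G i x u z}))"
    by (simp flip: of_nat_sum)
  also have "\<dots> \<le> (\<Sum>i\<in>X. \<Sum>u\<in>U i. b)"
  proof (intro sum_mono insert.prems(3))
    show "u \<in> W i" if "i \<in> X" "u \<in> U i" for i u using U(1) that by blast
  qed (use insert.hyps in auto)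
  also have "\<dots> = real (card X) * q * b" using U by simp
  finally have "card D \<le> real (card X) * q * b" .
  moreover have "real (card (W x - D)) = card (W x) - real (card D)"
    using DW finW by (simp add: card_Diff_subset finite_subset card_mono of_nat_diff)
  ultimately have "L \<le> card (W x - D)" using le insert.prems(2) [of x] by simp
  then obtain Ux where Ux: "Ux \<subseteq> W x - D" "card Ux = q" "Q Ux"
    using insert.prems(4) [of x "W x - D"] by blast
  have xG: "G i x u z" if "i \<in> X" "u \<in> U i" "z \<in> Ux" for i u z
    using that Ux(1) by (auto simp: D_def)
  let ?U = "U(x := Ux)"
  have "\<forall>i\<in>insert x X. ?U i \<subseteq> W i \<and> card (?U i) = q \<and> Q (?U i)" using U Ux by auto
  moreover have "\<forall>i\<in>insert x X. \<forall>j\<in>insert x X. i \<noteq> j \<longrightarrow> (\<forall>u\<in>?U i. \<forall>z\<in>?U j. G i j u z)"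
    using UG xG G insert.hyps by auto
  ultimately show ?case by blast
qed

text \<open>A greedy form of Turan's bound. At least half of the vertices have degree at most
  \<open>D\<close>, twice the permitted average. A maximal independent set of such vertices
  dominates all of them, reflexivity of \<open>Bad\<close> covering its own members, and hence has
  at least \<open>2 * t\<close> elements.\<close>

lemma independent_of_few_edges:
  assumes V: "finite V" "V \<noteq> {}" and bad: "\<And>v. v \<in> V \<Longrightarrow> Bad v v" "\<And>v w. Bad v w \<Longrightarrow> Bad w v"
    and t: "t > 0"
    and few: "(\<Sum>v\<in>V. real (card {w \<in> V. Bad v w})) \<le> (real (card V))\<^sup>2 / (8 * real t)"
  shows "\<exists>X\<subseteq>V. card X = t \<and> (\<forall>v\<in>X. \<forall>w\<in>X. v \<noteq> w \<longrightarrow> \<not> Bad v w)"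
proof -
  define N where "N = real (card V)"
  have N: "N > 0" using V by (simp add: N_def card_gt_0_iff)
  define D where "D = N / (4 * real t)"
  have D: "D > 0" using N t by (simp add: D_def)
  define low where "low = {v \<in> V. real (card {w \<in> V. Bad v w}) \<le> D}"
  define ind where "ind X \<longleftrightarrow> (\<forall>v\<in>X. \<forall>w\<in>X. v \<noteq> w \<longrightarrow> \<not> Bad v w)" for X
  have fin: "finite low" using V by (simp add: low_def)
  have "card (V - low) * D = (\<Sum>v\<in>V - low. D)" by simp
  also have "\<dots> \<le> (\<Sum>v\<in>V - low. real (card {w \<in> V. Bad v w}))"
    by (intro sum_mono) (auto simp: low_def)
  also have "\<dots> \<le> (\<Sum>v\<in>V. real (card {w \<in> V. Bad v w}))" using V by (intro sum_mono2) auto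
  also have "\<dots> \<le> N\<^sup>2 / (8 * real t)" using few by (simp add: N_def)
  also have "\<dots> = (N / 2) * D" using t by (simp add: D_def power2_eq_square)
  finally have "card (V - low) \<le> N / 2" using D by simp
  moreover have "N = card (V - low) + real (card low)"
    using V fin by (simp add: N_def low_def card_Diff_subset card_mono of_nat_diff)
  ultimately have cardlow: "card low \<ge> N / 2" by linarith
  obtain X where X: "X \<subseteq> low" "ind X" and max: "\<And>Z. Z \<subseteq> low \<Longrightarrow> ind Z \<Longrightarrow> X \<subseteq> Z \<Longrightarrow> Z = X"
    by (rule maximal_subset_exists [OF fin, of ind]) (auto simp: ind_def)
  have finX: "finite X" using X fin finite_subset by blast
  have "low \<subseteq> (\<Union>x\<in>X. {w \<in> V. Bad x w})"
  proof
    fix w assume w: "w \<in> low"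
    then have "w \<in> V" by (simp add: low_def)
    have "\<exists>x\<in>X. Bad x w"
    proof (cases "w \<in> X")
      case True
      then show ?thesis using bad(1) \<open>w \<in> V\<close> by blast
    next
      case False
      then have "\<not> ind (insert w X)" using max [of "insert w X"] X(1) w by blast
      then show ?thesis using X(2) bad(2) unfolding ind_def by blast
    qed
    then show "w \<in> (\<Union>x\<in>X. {w \<in> V. Bad x w})" using \<open>w \<in> V\<close> by blast
  qed
  then have "card low \<le> card (\<Union>x\<in>X. {w \<in> V. Bad x w})" using finX V by (intro card_mono) auto
  also have "\<dots> \<le> (\<Sum>x\<in>X. card {w \<in> V. Bad x w})" using finX by (rule card_UN_le)
  finally have "real (card low) \<le> (\<Sum>x\<in>X. real (card {w \<in> V. Bad x w}))" by (simp flip: of_nat_sum)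
  also have "\<dots> \<le> (\<Sum>x\<in>X. D)" using X(1) by (intro sum_mono) (auto simp: low_def)
  finally have "N / 2 \<le> card X * D" using cardlow by simp
  then have "t * D < card X * D" using N t by (simp add: D_def field_simps)
  then have "t \<le> card X" using D by simp
  then obtain X' where "X' \<subseteq> X" "card X' = t" by (meson obtain_subset_with_card_n)
  then show ?thesis using X unfolding ind_def low_def by (intro exI [of _ X']) blast
qed

text \<open>Double counting: \<open>u\<close> lies in \<open>P v\<close> for exactly the
  \<open>s\<close> vertices \<open>v\<close> of \<open>P u\<close>.\<close>

lemma sum_over_pieces:
  fixes g :: "'a \<Rightarrow> real"
  assumes "finite U" and P: "\<And>v. v \<in> U \<Longrightarrow> P v \<subseteq> U \<and> card (P v) = s"
    and sym: "\<And>u v. u \<in> P v \<Longrightarrow> v \<in> P u"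
  shows "(\<Sum>v\<in>U. \<Sum>u\<in>P v. g u) = s * (\<Sum>u\<in>U. g u)"
proof -
  have "(\<Sum>v\<in>U. \<Sum>u\<in>P v. g u) = (\<Sum>v\<in>U. \<Sum>u | u \<in> U \<and> u \<in> P v. g u)"
    using P by (intro sum.cong refl) auto
  also have "\<dots> = (\<Sum>u\<in>U. \<Sum>v | v \<in> U \<and> u \<in> P v. g u)"
    using assms(1) by (intro sum.swap_restrict)
  also have "\<dots> = (\<Sum>u\<in>U. \<Sum>v\<in>P u. g u)"
    using P sym by (intro sum.cong refl) blast
  also have "\<dots> = (\<Sum>u\<in>U. s * g u)" using P by (intro sum.cong) auto
  finally show ?thesis by (simp add: sum_distrib_left)
qed

text \<open>Moving from \<open>(v, w)\<close> to \<open>(u, z)\<close> through \<open>(u, w)\<close> changes one coordinate at a time,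
  and each such change is controlled by tightness of the pieces.\<close>

lemma sum_inconsistent_le:
  fixes e :: real
  assumes A: "symp A" and V: "finite V" and U: "U \<subseteq> V"
    and P: "\<And>v. v \<in> U \<Longrightarrow> P v \<subseteq> U \<and> card (P v) = s"
    and sym: "\<And>u v. u \<in> P v \<Longrightarrow> v \<in> P u"
    and tight: "\<And>u v. v \<in> U \<Longrightarrow> u \<in> P v \<Longrightarrow> card (differ A V v u) \<le> e * card V"
    and e: "e \<ge> 0"
  shows "(\<Sum>v\<in>U. \<Sum>w\<in>U. real (card {(u, z). u \<in> P v \<and> z \<in> P w \<and> A u z \<noteq> A v w}))
    \<le> 2 * (real s)\<^sup>2 * e * (real (card V))\<^sup>2"
proof -
  have finU: "finite U" using U V finite_subset by blast
  have finP: "finite (P v)" if "v \<in> U" for v using P [OF that] finU finite_subset by blast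
  have A': "A u v \<longleftrightarrow> A v u" for u v using A by (meson sympD)
  have D: "(\<Sum>w\<in>U. of_bool (A v w \<noteq> A u w)) \<le> e * card V" if "v \<in> U" "u \<in> P v" for u v
  proof -
    have "(\<Sum>w\<in>U. of_bool (A v w \<noteq> A u w)) = real (card {w \<in> U. A v w \<noteq> A u w})"
      using finU by (simp add: Int_def)
    also have "card {w \<in> U. A v w \<noteq> A u w} \<le> card (differ A V v u)"
      using U V by (intro card_mono) (auto simp: differ_def)
    finally show ?thesis using tight [OF that] by simp
  qed
  have bound: "(\<Sum>v\<in>U. \<Sum>u\<in>P v. s * (e * card V)) \<le> (real s)\<^sup>2 * e * (real (card V))\<^sup>2"
  proof -
    have "(\<Sum>v\<in>U. \<Sum>u\<in>P v. s * (e * card V)) = (\<Sum>v\<in>U. s * (s * (e * card V)))"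
      using P by (intro sum.cong refl) simp
    also have "\<dots> = card U * (s * (s * (e * card V)))" by simp
    also have "\<dots> \<le> card V * (s * (s * (e * card V)))"
      using U V e by (intro mult_right_mono) (auto intro: card_mono)
    finally show ?thesis by (simp add: power2_eq_square mult_ac)
  qed
  have cnt: "real (card {(u, z). u \<in> P v \<and> z \<in> P w \<and> A u z \<noteq> A v w})
      = (\<Sum>u\<in>P v. \<Sum>z\<in>P w. of_bool (A u z \<noteq> A v w))" if "v \<in> U" "w \<in> U" for v w
  proof -
    have "{(u, z). u \<in> P v \<and> z \<in> P w \<and> A u z \<noteq> A v w} = Sigma (P v) (\<lambda>u. {z \<in> P w. A u z \<noteq> A v w})"
      by auto
    then show ?thesis using finP that by (simp add: card_SigmaI Int_def)
  qed
  have "(\<Sum>v\<in>U. \<Sum>w\<in>U. real (card {(u, z). u \<in> P v \<and> z \<in> P w \<and> A u z \<noteq> A v w}))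
      = (\<Sum>v\<in>U. \<Sum>w\<in>U. \<Sum>u\<in>P v. \<Sum>z\<in>P w. of_bool (A u z \<noteq> A v w))"
    using cnt by (intro sum.cong refl)
  also have "\<dots> \<le> (\<Sum>v\<in>U. \<Sum>w\<in>U. \<Sum>u\<in>P v. \<Sum>z\<in>P w.
      of_bool (A v w \<noteq> A u w) + of_bool (A u w \<noteq> A u z))"
    by (intro sum_mono) auto
  also have "\<dots> = (\<Sum>v\<in>U. \<Sum>w\<in>U. \<Sum>u\<in>P v. \<Sum>z\<in>P w. of_bool (A v w \<noteq> A u w) :: real)
      + (\<Sum>v\<in>U. \<Sum>w\<in>U. \<Sum>u\<in>P v. \<Sum>z\<in>P w. of_bool (A u w \<noteq> A u z) :: real)"
    by (simp only: sum.distrib)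
  also have "(\<Sum>v\<in>U. \<Sum>w\<in>U. \<Sum>u\<in>P v. \<Sum>z\<in>P w. of_bool (A v w \<noteq> A u w) :: real)
      = (\<Sum>v\<in>U. \<Sum>w\<in>U. \<Sum>u\<in>P v. real s * of_bool (A v w \<noteq> A u w))"
    using P by (intro sum.cong refl) simp
  also have "\<dots> = (\<Sum>v\<in>U. \<Sum>u\<in>P v. real s * (\<Sum>w\<in>U. of_bool (A v w \<noteq> A u w)))"
    unfolding sum_distrib_left by (intro sum.cong refl sum.swap)
  also have "\<dots> \<le> (\<Sum>v\<in>U. \<Sum>u\<in>P v. s * (e * card V))"
    using D by (intro sum_mono mult_left_mono) auto
  also have "\<dots> \<le> (real s)\<^sup>2 * e * (real (card V))\<^sup>2" by (rule bound)
  \<comment> \<open>The summand is free of \<open>v\<close>, so the sums over \<open>v\<close> and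
    \<open>u\<close> visit every \<open>u\<close> in \<open>U\<close> exactly \<open>s\<close>
    times. Symmetry of \<open>A\<close> then turns the change from \<open>w\<close> to
    \<open>z\<close> into a difference of neighbourhoods within one piece.\<close>
  also have "(\<Sum>v\<in>U. \<Sum>w\<in>U. \<Sum>u\<in>P v. \<Sum>z\<in>P w. of_bool (A u w \<noteq> A u z) :: real)
      = (\<Sum>w\<in>U. \<Sum>v\<in>U. \<Sum>u\<in>P v. \<Sum>z\<in>P w. of_bool (A u w \<noteq> A u z) :: real)"
    by (rule sum.swap)
  also have "\<dots> = (\<Sum>w\<in>U. real s * (\<Sum>u\<in>U. \<Sum>z\<in>P w. of_bool (A u w \<noteq> A u z) :: real))"
  proof (rule sum.cong [OF refl])
    fix w
    show "(\<Sum>v\<in>U. \<Sum>u\<in>P v. \<Sum>z\<in>P w. of_bool (A u w \<noteq> A u z))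
        = real s * (\<Sum>u\<in>U. \<Sum>z\<in>P w. of_bool (A u w \<noteq> A u z))"
      by (rule sum_over_pieces [OF finU P sym])
  qed
  also have "\<dots> = (\<Sum>w\<in>U. \<Sum>z\<in>P w. real s * (\<Sum>u\<in>U. of_bool (A w u \<noteq> A z u)))"
  proof (rule sum.cong [OF refl])
    fix w
    have "(\<Sum>u\<in>U. \<Sum>z\<in>P w. of_bool (A u w \<noteq> A u z) :: real) = (\<Sum>z\<in>P w. \<Sum>u\<in>U. of_bool (A w u \<noteq> A z u) :: real)"
      using A' by (subst sum.swap) simp
    then show "real s * (\<Sum>u\<in>U. \<Sum>z\<in>P w. of_bool (A u w \<noteq> A u z) :: real)
        = (\<Sum>z\<in>P w. real s * (\<Sum>u\<in>U. of_bool (A w u \<noteq> A z u)))"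
      by (simp only: sum_distrib_left)
  qed
  also have "\<dots> \<le> (\<Sum>w\<in>U. \<Sum>z\<in>P w. s * (e * card V))"
    using D by (intro sum_mono mult_left_mono) auto
  also have "\<dots> \<le> (real s)\<^sup>2 * e * (real (card V))\<^sup>2" by (rule bound)
  finally show ?thesis by (simp add: mult_ac)
qed

text \<open>Markov's inequality for counting.\<close>

lemma card_exceeding_le:
  fixes f :: "'a \<Rightarrow> real"
  assumes "finite U" "K > 0" "\<And>u. u \<in> U \<Longrightarrow> f u \<ge> 0"
  shows "card {u \<in> U. K < f u} \<le> sum f U / K"
proof -
  have "card {u \<in> U. K < f u} * K = (\<Sum>u | u \<in> U \<and> K < f u. K)" by simp
  also have "\<dots> \<le> (\<Sum>u | u \<in> U \<and> K < f u. f u)" by (intro sum_mono) auto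
  also have "\<dots> \<le> sum f U" using assms by (intro sum_mono2) auto
  finally show ?thesis using assms by (simp add: field_simps)
qed

text \<open>Every covered vertex is a candidate representative of its own piece. On average over
  pairs of candidates few adjacencies disagree, so most pairs are good, and the Turan-type bound
  finds \<open>t\<close> candidates that are pairwise good.\<close>

lemma consistent_pieces_exist:
  fixes t s :: nat
  assumes A: "symp A" and vc: "vc_le d A V" and d: "d > 0" and V: "finite V" "V \<noteq> {}"
    and t: "t > 0" and s: "s > 0"
    and s1: "((8 * real d + 6) * (1024 * real t ^ 4)) ^ (2 * d) * s \<le> card V / 2"
    and s2: "s \<le> card V / (64 * real t)"
  shows "\<exists>X W. X \<subseteq> V \<and> card X = t \<and> (\<forall>i\<in>X. W i \<subseteq> V \<and> card (W i) = s) \<and> disjoint_family_on W X \<and>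
    (\<forall>i\<in>X. \<forall>j\<in>X. i \<noteq> j \<longrightarrow>
      card {(u, z). u \<in> W i \<and> z \<in> W j \<and> A u z \<noteq> A i j} \<le> (real s)\<^sup>2 / (8 * real t ^ 3))"
proof -
  define n where "n = real (card V)"
  have n: "n > 0" using V by (simp add: n_def card_gt_0_iff)
  define e where "e = 1 / (1024 * real t ^ 4)"
  have t4: "real t ^ 4 \<ge> 1" using t by (intro one_le_power) simp
  have "1024 * real t ^ 4 \<ge> 1" using t4 by linarith
  then have e: "0 < e" "e \<le> 1" using t by (auto simp: e_def)
  have "\<exists>\<W>. disjoint \<W> \<and> \<Union>\<W> \<subseteq> V \<and> (\<forall>W\<in>\<W>. card W = s \<and>
      (\<forall>u\<in>W. \<forall>v\<in>W. card (differ A V u v) \<le> e * card V)) \<and> card (V - \<Union>\<W>) \<le> n / 2"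
  proof (rule disjoint_pieces [OF V(1) s])
    fix R assume "R \<subseteq> V" "n / 2 \<le> card R"
    then show "\<exists>W\<subseteq>R. card W = s \<and> (\<forall>u\<in>W. \<forall>v\<in>W. card (differ A V u v) \<le> e * card V)"
      using s1 s by (intro tight_subset_exists [OF vc d V(1) e]) (auto simp: e_def n_def)
  qed
  then obtain \<W> where \<W>: "disjoint \<W>" "\<Union>\<W> \<subseteq> V"
    and pieces: "\<forall>W\<in>\<W>. card W = s \<and> (\<forall>u\<in>W. \<forall>v\<in>W. card (differ A V u v) \<le> e * card V)"
    and rest: "card (V - \<Union>\<W>) \<le> n / 2" by (elim exE conjE)
  have piece: "card W = s" if "W \<in> \<W>" for W using pieces that by blast
  have tight: "card (differ A V u v) \<le> e * card V" if "W \<in> \<W>" "u \<in> W" "v \<in> W" for W u v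
    using pieces that by blast
  define U where "U = \<Union>\<W>"
  have U: "U \<subseteq> V" "finite U" using \<W> V finite_subset by (auto simp: U_def)
  have "n = card U + real (card (V - U))"
    using U V by (simp add: n_def card_Diff_subset card_mono of_nat_diff)
  then have cardU: "card U \<ge> n / 2" using rest by (simp add: U_def)
  have Une: "U \<noteq> {}" using cardU n by auto
  \<comment> \<open>The piece containing \<open>v\<close>. As a union it is empty for uncovered
    \<open>v\<close>, so the inclusion in \<open>U\<close> and the symmetry hold without a side
    condition.\<close>
  define P where "P v = \<Union>{W \<in> \<W>. v \<in> W}" for v
  have P_eq: "P v = W" if "W \<in> \<W>" "v \<in> W" for v W
  proof -
    have "W' = W" if "W' \<in> \<W>" "v \<in> W'" for W'
      using \<W>(1) \<open>W \<in> \<W>\<close> \<open>v \<in> W\<close> that by (auto dest: disjointD)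
    then have "{W \<in> \<W>. v \<in> W} = {W}" using that by blast
    then show ?thesis by (simp add: P_def)
  qed
  have in_P: "P v \<in> \<W>" "v \<in> P v" if "v \<in> U" for v
    using that P_eq by (auto simp: U_def)
  have P_sub: "P v \<subseteq> U" for v by (auto simp: P_def U_def)
  have P_sym: "u \<in> P v \<Longrightarrow> v \<in> P u" for u v by (auto simp: P_def)
  have card_P: "card (P v) = s" if "v \<in> U" for v using piece in_P that by blast
  define cnt where "cnt v w = real (card {(u, z). u \<in> P v \<and> z \<in> P w \<and> A u z \<noteq> A v w})" for v w
  have cnt_sym: "cnt w v = cnt v w" for v w
  proof -
    have "{(u, z). u \<in> P w \<and> z \<in> P v \<and> A u z \<noteq> A w v}
        = prod.swap ` {(u, z). u \<in> P v \<and> z \<in> P w \<and> A u z \<noteq> A v w}"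
      using sympD [OF A] by (auto simp: image_iff)
    then show ?thesis by (simp add: cnt_def card_image)
  qed
  define K where "K = (real s)\<^sup>2 / (8 * real t ^ 3)"
  have K: "K > 0" using s t by (simp add: K_def)
  \<comment> \<open>The first alternative forces chosen representatives into different pieces and
    makes \<open>Bad\<close> reflexive.\<close>
  define Bad where "Bad v w \<longleftrightarrow> w \<in> P v \<or> K < cnt v w" for v w
  have "\<exists>X\<subseteq>U. card X = t \<and> (\<forall>v\<in>X. \<forall>w\<in>X. v \<noteq> w \<longrightarrow> \<not> Bad v w)"
  proof (rule independent_of_few_edges [OF U(2) Une _ _ t])
    show "Bad v v" if "v \<in> U" for v using in_P that by (simp add: Bad_def)
    show "Bad w v" if "Bad v w" for v w using that P_sym cnt_sym by (auto simp: Bad_def)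
    have "(\<Sum>v\<in>U. real (card {w \<in> U. Bad v w})) \<le> (\<Sum>v\<in>U. s + (\<Sum>w\<in>U. cnt v w) / K)"
    proof (rule sum_mono)
      fix v assume v: "v \<in> U"
      have "{w \<in> U. Bad v w} = P v \<union> {w \<in> U. K < cnt v w}" using P_sub by (auto simp: Bad_def)
      then have "card {w \<in> U. Bad v w} \<le> s + card {w \<in> U. K < cnt v w}"
        using card_Un_le card_P [OF v] by metis
      moreover have "card {w \<in> U. K < cnt v w} \<le> (\<Sum>w\<in>U. cnt v w) / K"
        using U K by (intro card_exceeding_le) (auto simp: cnt_def)
      ultimately show "real (card {w \<in> U. Bad v w}) \<le> s + (\<Sum>w\<in>U. cnt v w) / K" by linarith
    qed
    also have "\<dots> = card U * real s + (\<Sum>v\<in>U. \<Sum>w\<in>U. cnt v w) / K"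
      by (simp add: sum.distrib sum_divide_distrib)
    also have "\<dots> \<le> n * (n / (64 * real t)) + (2 * (real s)\<^sup>2 * e * n\<^sup>2) / K"
    proof (intro add_mono mult_mono divide_right_mono)
      show "real (card U) \<le> n" using U V by (simp add: n_def card_mono)
      show "real s \<le> n / (64 * real t)" using s2 by (simp add: n_def)
      show "(\<Sum>v\<in>U. \<Sum>w\<in>U. cnt v w) \<le> 2 * (real s)\<^sup>2 * e * n\<^sup>2"
        unfolding cnt_def n_def
      proof (rule sum_inconsistent_le [OF A V(1) U(1)])
        show "card (differ A V v u) \<le> e * card V" if "v \<in> U" "u \<in> P v" for u v
          using that tight in_P by blast
      qed (use P_sub card_P P_sym e in auto)
    qed (use n K in auto)
    \<comment> \<open>The choice of \<open>e\<close> makes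
      \<open>2 * s\<^sup>2 * e * n\<^sup>2 / K\<close> equal to \<open>n\<^sup>2 / (64 * t)\<close>,
      the same as the bound for pairs within a piece. Their sum is what the Turan-type bound allows
      on \<open>n / 2\<close> vertices.\<close>
    also have "\<dots> = n\<^sup>2 / (32 * real t)"
      using s t by (simp add: K_def e_def field_simps power2_eq_square power3_eq_cube power4_eq_xxxx)
    also have "\<dots> = (n / 2)\<^sup>2 / (8 * real t)" by (simp add: power_divide)
    also have "\<dots> \<le> (real (card U))\<^sup>2 / (8 * real t)"
      using cardU n by (intro divide_right_mono power_mono) auto
    finally show "(\<Sum>v\<in>U. real (card {w \<in> U. Bad v w})) \<le> (real (card U))\<^sup>2 / (8 * real t)" .
  qed
  then obtain X where "X \<subseteq> U \<and> card X = t \<and> (\<forall>v\<in>X. \<forall>w\<in>X. v \<noteq> w \<longrightarrow> \<not> Bad v w)" ..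
  then have X: "X \<subseteq> U" "card X = t" and good: "\<forall>v\<in>X. \<forall>w\<in>X. v \<noteq> w \<longrightarrow> \<not> Bad v w" by simp_all
  have "disjoint_family_on P X"
    unfolding disjoint_family_on_def
  proof (intro ballI impI)
    fix v w assume vw: "v \<in> X" "w \<in> X" "v \<noteq> w"
    then have "P v \<in> \<W>" "P w \<in> \<W>" "w \<in> P w" "w \<notin> P v"
      using in_P X good vw by (auto simp: Bad_def)
    then show "P v \<inter> P w = {}" using disjointD [OF \<W>(1)] by metis
  qed
  moreover have "card {(u, z). u \<in> P i \<and> z \<in> P j \<and> A u z \<noteq> A i j} \<le> (real s)\<^sup>2 / (8 * real t ^ 3)"
    if "i \<in> X" "j \<in> X" "i \<noteq> j" for i j
  proof -
    have "\<not> Bad i j" using good that by blast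
    then show ?thesis by (simp add: Bad_def K_def cnt_def)
  qed
  ultimately show ?thesis
    using X U P_sub card_P by (intro exI [of _ X] exI [of _ P]) blast
qed

section \<open>The product step for induced cographs\<close>

type_synonym 'a rel_graph = "('a \<Rightarrow> 'a \<Rightarrow> bool) \<times> 'a set"

definition vc_graphs :: "nat \<Rightarrow> 'a rel_graph set" where
  "vc_graphs d = {(A, V). symp A \<and> finite V \<and> vc_le d A V}"

text \<open>States \<open>F (ln x) \<ge> ln m\<close> for the function \<open>F\<close> of the
  overview. A relation between reals needs no rounding and no minimum over all graphs.\<close>

definition cograph_bound :: "'a rel_graph set \<Rightarrow> real \<Rightarrow> real \<Rightarrow> bool" where
  "cograph_bound \<G> x m \<longleftrightarrow> (\<forall>A V. (A, V) \<in> \<G> \<longrightarrow> x \<le> card V \<longrightarrow> (\<exists>X\<subseteq>V. cograph A X \<and> m \<le> card X))"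

lemma cograph_boundD:
  fixes A :: "'a \<Rightarrow> 'a \<Rightarrow> bool"
  assumes "cograph_bound (vc_graphs d :: 'a rel_graph set) x m" "symp A" "finite V" "vc_le d A V" "V' \<subseteq> V" "x \<le> card V'"
  shows "\<exists>X\<subseteq>V'. cograph A X \<and> m \<le> card X"
proof -
  have V': "(A, V') \<in> vc_graphs d"
    using assms vc_le_subset finite_subset by (auto simp: vc_graphs_def)
  show ?thesis by (rule assms(1) [unfolded cograph_bound_def, rule_format, OF V' assms(6)])
qed

text \<open>A cograph \<open>Y\<close> among the representatives is blown up by cographs inside the
  cleaned pieces. The sizes are budgeted as follows: atypical vertices take at most
  \<open>s / 2\<close> from a piece, conflicts with earlier choices at most \<open>s / 4\<close>,
  and the remaining \<open>s / 4 \<ge> x\<close> vertices still contain a cograph of size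
  \<open>b\<close>.\<close>

lemma cograph_in_consistent_pieces:
  fixes A :: "'a \<Rightarrow> 'a \<Rightarrow> bool" and t s :: nat and a b x :: real
  assumes A: "symp A" and vc: "vc_le d A V" and V: "finite V"
    and X: "X \<subseteq> V" "card X = t" and W: "\<And>i. i \<in> X \<Longrightarrow> W i \<subseteq> V \<and> card (W i) = s"
    and disj: "disjoint_family_on W X"
    and cons: "\<And>i j. i \<in> X \<Longrightarrow> j \<in> X \<Longrightarrow> i \<noteq> j \<Longrightarrow>
      card {(u, z). u \<in> W i \<and> z \<in> W j \<and> A u z \<noteq> A i j} \<le> (real s)\<^sup>2 / (8 * real t ^ 3)"
    and t: "t > 0" and s: "s > 0" "x \<le> s / 4"
    and Ha: "cograph_bound (vc_graphs d :: 'a rel_graph set) (real t) a"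
    and Hb: "cograph_bound (vc_graphs d :: 'a rel_graph set) x b"
    and ab: "0 \<le> a" "1 \<le> b" "b \<le> real t"
  shows "\<exists>Z\<subseteq>V. cograph A Z \<and> a * b \<le> card Z"
proof -
  have finX: "finite X" using X V finite_subset by blast
  have finW: "finite (W i)" if "i \<in> X" for i using W [OF that] V finite_subset by blast
  obtain Y where Y: "Y \<subseteq> X" "cograph A Y" "a \<le> card Y"
    using cograph_boundD [OF Ha A V vc X(1)] X(2) by auto
  have finY: "finite Y" using Y finX finite_subset by blast
  have cardY: "card Y \<le> t" using Y X finX card_mono by metis
  \<comment> \<open>With this threshold each other piece makes at most \<open>s / (2 * t)\<close>
    vertices of \<open>W i\<close> atypical, while \<open>t * t\<close> chosen vertices spoil at
    most \<open>t * t * K = s / 4\<close> vertices of a further piece.\<close>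
  define K where "K = real s / (4 * (real t)\<^sup>2)"
  have K: "K > 0" using s t by (simp add: K_def)
  define W' where "W' i = {u \<in> W i. \<forall>j\<in>X - {i}. card {z \<in> W j. A u z \<noteq> A i j} \<le> K}" for i
  have W'_sub: "W' i \<subseteq> W i" for i by (auto simp: W'_def)
  have cardW': "s / 2 \<le> card (W' i)" if i: "i \<in> X" for i
  proof -
    define D where "D j = {u \<in> W i. K < card {z \<in> W j. A u z \<noteq> A i j}}" for j
    have cardD: "card (D j) \<le> s / (2 * real t)" if j: "j \<in> X - {i}" for j
    proof -
      have "{(u, z). u \<in> W i \<and> z \<in> W j \<and> A u z \<noteq> A i j} = Sigma (W i) (\<lambda>u. {z \<in> W j. A u z \<noteq> A i j})"
        by auto
      then have "(\<Sum>u\<in>W i. real (card {z \<in> W j. A u z \<noteq> A i j}))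
          = card {(u, z). u \<in> W i \<and> z \<in> W j \<and> A u z \<noteq> A i j}"
        using finW i j by (simp add: card_SigmaI)
      also have "\<dots> \<le> (real s)\<^sup>2 / (8 * real t ^ 3)" using cons [of i j] i j by auto
      finally have "(\<Sum>u\<in>W i. real (card {z \<in> W j. A u z \<noteq> A i j})) / K
          \<le> (real s)\<^sup>2 / (8 * real t ^ 3) / K" using K by (intro divide_right_mono) auto
      also have "\<dots> = s / (2 * real t)"
        using s t by (simp add: K_def field_simps power2_eq_square power3_eq_cube)
      finally show ?thesis
        using card_exceeding_le [of "W i" K "\<lambda>u. real (card {z \<in> W j. A u z \<noteq> A i j})"] K finW [OF i]
        by (simp add: D_def)
    qed
    have "W i - W' i \<subseteq> (\<Union>j\<in>X - {i}. D j)" by (auto simp: W'_def D_def not_le)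
    then have "card (W i - W' i) \<le> card (\<Union>j\<in>X - {i}. D j)"
      using finX finW i by (intro card_mono) (auto simp: D_def)
    also have "\<dots> \<le> (\<Sum>j\<in>X - {i}. card (D j))" using finX by (intro card_UN_le) simp
    finally have "real (card (W i - W' i)) \<le> (\<Sum>j\<in>X - {i}. real (card (D j)))"
      by (simp flip: of_nat_sum)
    also have "\<dots> \<le> (\<Sum>j\<in>X - {i}. s / (2 * real t))" using cardD by (intro sum_mono)
    also have "\<dots> \<le> (\<Sum>j\<in>X. s / (2 * real t))" using finX by (intro sum_mono2) auto
    also have "\<dots> = s / 2" using X t by simp
    finally have "card (W i - W' i) \<le> real s / 2" .
    moreover have "real (card (W i - W' i)) = s - real (card (W' i))"
      using W'_sub [of i] finW [OF i] W [OF i]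
      by (simp add: card_Diff_subset finite_subset card_mono of_nat_diff)
        (metis card_mono of_nat_diff)
    ultimately show ?thesis by linarith
  qed
  \<comment> \<open>The cographs are trimmed to the common size \<open>q\<close>;
    \<open>b \<le> t\<close> gives \<open>q \<le> t\<close>, because \<open>t\<close> is an
    integer.\<close>
  define q where "q = nat \<lceil>b\<rceil>"
  have q: "q > 0" "b \<le> q" "q \<le> t" using ab by (auto simp: q_def)
  define G where "G i j u z \<longleftrightarrow> A u z = A i j" for i j u z
  have "\<exists>U. (\<forall>i\<in>Y. U i \<subseteq> W' i \<and> card (U i) = q \<and> cograph A (U i)) \<and>
    (\<forall>i\<in>Y. \<forall>j\<in>Y. i \<noteq> j \<longrightarrow> (\<forall>u\<in>U i. \<forall>z\<in>U j. G i j u z))"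
  proof (rule greedy_transversal [OF finY])
    have "real (card Y) * q * K \<le> real t * t * K"
      using cardY q K by (intro mult_right_mono mult_mono) auto
    also have "\<dots> = s / 4" using t by (simp add: K_def power2_eq_square)
    finally show "real (card Y) * q * K + s / 4 \<le> s / 2" by simp
    show "finite (W' i) \<and> s / 2 \<le> card (W' i)" if "i \<in> Y" for i
      using cardW' [of i] finite_subset [OF W'_sub finW] that Y(1) by blast
    show "card {z \<in> W' j. \<not> G i j u z} \<le> K" if "i \<in> Y" "j \<in> Y" "i \<noteq> j" "u \<in> W' i" for i j u
    proof -
      have "card {z \<in> W' j. \<not> G i j u z} \<le> card {z \<in> W j. A u z \<noteq> A i j}"
        using finW [of j] that Y W'_sub by (intro card_mono) (auto simp: G_def)
      also have "\<dots> \<le> K" using that Y by (auto simp: W'_def)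
      finally show ?thesis by simp
    qed
    show "G j i z u" if "G i j u z" for i j u z
      using that sympD [OF A] unfolding G_def by metis
    show "\<exists>U\<subseteq>S. card U = q \<and> cograph A U" if "i \<in> Y" "S \<subseteq> W' i" and S: "s / 4 \<le> card S" for i S
    proof -
      have "S \<subseteq> V" using that W'_sub W Y by blast
      then obtain T where T: "T \<subseteq> S" "cograph A T" "b \<le> card T"
        using cograph_boundD [OF Hb A V vc, of S] order_trans [OF s(2) S] by blast
      then have "q \<le> card T" by (simp add: q_def)
      then obtain U where "U \<subseteq> T" "card U = q" by (meson obtain_subset_with_card_n)
      then show ?thesis using T cograph_subset by blast
    qed
  qed (use K q in auto)
  then obtain U where U': "\<forall>i\<in>Y. U i \<subseteq> W' i \<and> card (U i) = q \<and> cograph A (U i)"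
    and UG: "\<forall>i\<in>Y. \<forall>j\<in>Y. i \<noteq> j \<longrightarrow> (\<forall>u\<in>U i. \<forall>z\<in>U j. G i j u z)"
    by (elim exE conjE)
  have U: "U i \<subseteq> W' i" "card (U i) = q" "cograph A (U i)" if "i \<in> Y" for i using U' that by auto
  have UW: "U i \<subseteq> W i" if "i \<in> Y" for i using U(1) [OF that] W'_sub by blast
  have disjU: "disjoint_family_on U Y"
    unfolding disjoint_family_on_def
  proof (intro ballI impI)
    fix i j assume ij: "i \<in> Y" "j \<in> Y" "i \<noteq> j"
    then have "W i \<inter> W j = {}" using disjoint_family_onD [OF disj, of i j] Y(1) by blast
    then show "U i \<inter> U j = {}" using UW ij by blast
  qed
  have "cograph A (\<Union>i\<in>Y. U i)"
    by (rule cograph_substitution [OF Y(2) _ disjU]) (use U(3) UG in \<open>auto simp: G_def\<close>)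
  moreover have "(\<Union>i\<in>Y. U i) \<subseteq> V" using UW W Y by blast
  moreover have "a * b \<le> card (\<Union>i\<in>Y. U i)"
  proof -
    have "card (\<Union>i\<in>Y. U i) = (\<Sum>i\<in>Y. card (U i))"
    proof (rule card_UN_disjoint [OF finY])
      show "\<forall>i\<in>Y. finite (U i)" using U(3) cograph_finite by blast
      show "\<forall>i\<in>Y. \<forall>j\<in>Y. i \<noteq> j \<longrightarrow> U i \<inter> U j = {}" using disjU by (auto simp: disjoint_family_on_def)
    qed
    also have "\<dots> = card Y * q" using U by simp
    finally have "real (card (\<Union>i\<in>Y. U i)) = real (card Y) * q" by simp
    moreover have "a * b \<le> real (card Y) * real q" using ab Y q by (intro mult_mono) auto
    ultimately show ?thesis by simp
  qed
  ultimately show ?thesis by blast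
qed

text \<open>The required number of vertices is polynomial in \<open>t\<close> times
  \<open>x\<close>. Since \<open>t \<ge> 2\<close>, constant factors also disappear into a power of
  \<open>t\<close>, so a single exponent \<open>C\<close> depending only on \<open>d\<close>
  suffices.\<close>

lemma cograph_bound_step:
  assumes d: "d > 0"
  obtains C :: nat where "\<And>(t::nat) a x b. 2 \<le> t \<Longrightarrow> cograph_bound (vc_graphs d :: 'a rel_graph set) (real t) a \<Longrightarrow>
    cograph_bound (vc_graphs d :: 'a rel_graph set) x b \<Longrightarrow>
    1 \<le> x \<Longrightarrow> 0 \<le> a \<Longrightarrow> 1 \<le> b \<Longrightarrow> b \<le> real t \<Longrightarrow>
    cograph_bound (vc_graphs d :: 'a rel_graph set) (x * real t ^ C) (a * b)"
proof -
  \<comment> \<open>\<open>320 * t * M\<close> equals \<open>c * t ^ (8 * d + 1)\<close>: the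
    tightness \<open>1 / (1024 * t ^ 4)\<close> enters the packing bound with exponent
    \<open>2 * d\<close>. The factor \<open>c\<close> is absorbed by
    \<open>c \<le> 2 ^ c \<le> t ^ c\<close>.\<close>
  define c where "c = (320::nat) * ((8 * d + 6) * 1024) ^ (2 * d)"
  define C where "C = c + (8 * d + 1)"
  show thesis
  proof (rule that)
    fix t :: nat and a x b :: real
    assume t: "t \<ge> 2"
      and Ha: "cograph_bound (vc_graphs d :: 'a rel_graph set) (real t) a"
      and Hb: "cograph_bound (vc_graphs d :: 'a rel_graph set) x b"
      and x: "1 \<le> x" and ab: "0 \<le> a" "1 \<le> b" "b \<le> real t"
    define M where "M = ((8 * real d + 6) * (1024 * real t ^ 4)) ^ (2 * d)"
    have t4: "real t ^ 4 \<ge> 1" using t by (intro one_le_power) simp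
    have "1 * 1 \<le> (8 * real d + 6) * (1024 * real t ^ 4)" using t4 by (intro mult_mono) auto
    then have M: "M \<ge> 1" unfolding M_def by (intro one_le_power) simp
    have "c \<le> 2 ^ c" by (rule less_imp_le [OF less_exp])
    also have "\<dots> \<le> t ^ c" using t by (intro power_mono) auto
    finally have "real c \<le> real t ^ c" by (metis of_nat_le_iff of_nat_power)
    then have "real c * real t ^ (8 * d + 1) \<le> real t ^ c * real t ^ (8 * d + 1)"
      by (intro mult_right_mono) auto
    moreover have "real c * real t ^ (8 * d + 1) = 320 * real t * M"
    proof -
      have "M = ((8 * real d + 6) * 1024) ^ (2 * d) * (real t ^ 4) ^ (2 * d)"
        unfolding M_def by (simp only: mult.assoc [symmetric] power_mult_distrib)
      moreover have "(real t ^ 4) ^ (2 * d) = real t ^ (8 * d)" by (simp flip: power_mult)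
      ultimately show ?thesis by (simp add: c_def)
    qed
    ultimately have tC: "320 * real t * M \<le> real t ^ C" by (simp only: C_def power_add)
    show "cograph_bound (vc_graphs d :: 'a rel_graph set) (x * real t ^ C) (a * b)"
      unfolding cograph_bound_def
    proof (intro allI impI)
      fix A :: "'a \<Rightarrow> 'a \<Rightarrow> bool" and V
      assume "(A, V) \<in> vc_graphs d" and n: "x * real t ^ C \<le> card V"
      then have A: "symp A" and V: "finite V" and vc: "vc_le d A V" by (auto simp: vc_graphs_def)
      \<comment> \<open>The divisor meets both size conditions on the pieces. As
        \<open>320 = 5 * 64\<close>, it leaves \<open>r \<ge> 5 * x\<close>, and rounding down still
        gives \<open>s \<ge> 4 * x\<close> because \<open>x \<ge> 1\<close>.\<close>
      define r where "r = card V / (64 * real t * M)"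
      define s where "s = nat \<lfloor>r\<rfloor>"
      have "x * (320 * real t * M) \<le> card V"
        using n tC x order_trans [OF mult_left_mono [OF tC, of x]] by simp
      then have "5 * x \<le> r" using t M by (simp add: r_def field_simps)
      then have s4: "4 * x \<le> s" using x by (simp add: s_def) linarith
      have s0: "s > 0" using s4 x by (cases s) auto
      have "s \<le> r" using s0 by (simp add: s_def)
      then have sM: "s * (64 * real t * M) \<le> card V" using t M by (simp add: r_def field_simps)
      have "0 < s * (64 * real t * M)" using s0 t M by simp
      then have "V \<noteq> {}" using sM by auto
      have M2: "M * s * 2 \<le> s * (64 * real t * M)"
        using mult_mono [of 2 "64 * real t" "M * s" "M * s"] M t by (simp add: mult_ac)
      then have s1: "M * s \<le> card V / 2" using order_trans [OF M2 sM] by simp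
      have "real s * (64 * real t) * 1 \<le> real s * (64 * real t) * M" using M by (intro mult_left_mono) auto
      then have "real s * (64 * real t) \<le> card V" using sM by (simp add: mult_ac)
      then have s2: "s \<le> card V / (64 * real t)" using t by (simp add: field_simps)
      have t0: "t > 0" using t by simp
      obtain X W where X: "X \<subseteq> V" "card X = t" and W: "\<forall>i\<in>X. W i \<subseteq> V \<and> card (W i) = s"
        "disjoint_family_on W X" and cons: "\<forall>i\<in>X. \<forall>j\<in>X. i \<noteq> j \<longrightarrow>
          card {(u, z). u \<in> W i \<and> z \<in> W j \<and> A u z \<noteq> A i j} \<le> (real s)\<^sup>2 / (8 * real t ^ 3)"
        using consistent_pieces_exist [OF A vc d V \<open>V \<noteq> {}\<close> t0 s0 s1 [unfolded M_def] s2]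
        by (elim exE conjE)
      show "\<exists>X\<subseteq>V. cograph A X \<and> a * b \<le> card X"
      proof (rule cograph_in_consistent_pieces [OF A vc V X _ W(2) _ t0 s0 _ Ha Hb ab])
        show "W i \<subseteq> V \<and> card (W i) = s" if "i \<in> X" for i using W(1) that by blast
        show "card {(u, z). u \<in> W i \<and> z \<in> W j \<and> A u z \<noteq> A i j} \<le> (real s)\<^sup>2 / (8 * real t ^ 3)"
          if "i \<in> X" "j \<in> X" "i \<noteq> j" for i j using cons that by blast
        show "x \<le> s / 4" using s4 by simp
      qed
    qed
  qed
qed

section \<open>The growth rate\<close>

text \<open>Diagonalisation: \<open>\<epsilon> n\<close> is eventually the least
  \<open>1 / k\<close> with \<open>k \<le> n\<close> that works at \<open>n\<close>. Every fixed
  \<open>k\<close> works from some point on, so these values tend to 0; \<open>P\<close> need not be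
  monotone in its first argument.\<close>

lemma diagonal_null_sequence:
  fixes P :: "real \<Rightarrow> nat \<Rightarrow> bool"
  assumes ev: "\<And>\<delta>. \<delta> > 0 \<Longrightarrow> eventually (P \<delta>) sequentially"
    and ex: "\<And>n. n \<ge> N \<Longrightarrow> \<exists>\<delta>. P \<delta> n"
  shows "\<exists>\<epsilon>. \<epsilon> \<longlonglongrightarrow> 0 \<and> (\<forall>n\<ge>N. P (\<epsilon> n) n)"
proof -
  define S where "S n = {k::nat. k \<le> n \<and> k > 0 \<and> P (1 / k) n}" for n
  define \<epsilon>' where "\<epsilon>' n = 1 / real (Max (S n))" for n
  \<comment> \<open>For the early \<open>n\<close> where \<open>S n\<close> may be empty, its
    \<open>Max\<close> carries no information and any working value is taken instead.\<close>
  define \<epsilon> where "\<epsilon> n = (if P (\<epsilon>' n) n then \<epsilon>' n else (SOME \<delta>. P \<delta> n))" for n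
  have fin: "finite (S n)" for n by (simp add: S_def)
  have evS: "\<forall>\<^sub>F n in sequentially. k \<in> S n" if "k > 0" for k
    using eventually_conj [OF ev [of "1 / k"] eventually_ge_at_top [of k]] that
    by (simp add: S_def conj_commute)
  have evP: "\<forall>\<^sub>F n in sequentially. P (\<epsilon>' n) n"
    using evS [of 1, simplified]
  proof eventually_elim
    case (elim n)
    then have "Max (S n) \<in> S n" using fin by (intro Max_in) auto
    then show ?case by (simp add: S_def \<epsilon>'_def)
  qed
  have "\<epsilon>' \<longlonglongrightarrow> 0"
  proof (rule LIMSEQ_I)
    fix r :: real assume "r > 0"
    then obtain k where k: "k > 0" "1 / real k < r"
      by (metis inverse_eq_divide real_arch_inverse of_nat_0_less_iff zero_less_iff_neq_zero)
    have "\<forall>\<^sub>F n in sequentially. norm (\<epsilon>' n - 0) < r"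
      using evS [OF k(1)]
    proof eventually_elim
      case (elim n)
      then have "k \<le> Max (S n)" using fin by (intro Max_ge)
      then have "1 / real (Max (S n)) \<le> 1 / real k" using k by (intro divide_left_mono) auto
      then show ?case using k by (simp add: \<epsilon>'_def)
    qed
    then show "\<exists>no. \<forall>n\<ge>no. norm (\<epsilon>' n - 0) < r" by (simp add: eventually_sequentially)
  qed
  moreover have "\<forall>\<^sub>F n in sequentially. \<epsilon>' n = \<epsilon> n" using evP by eventually_elim (simp add: \<epsilon>_def)
  ultimately have "\<epsilon> \<longlonglongrightarrow> 0" by (rule Lim_transform_eventually)
  moreover have "P (\<epsilon> n) n" if "n \<ge> N" for n
    using ex [OF that] by (auto simp: \<epsilon>_def intro: someI)
  ultimately show ?thesis by blast
qed

lemma eventually_powr_ge: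
  fixes K :: real
  assumes "\<delta> > 0"
  shows "\<forall>\<^sub>F x in at_top. K \<le> x powr \<delta>"
  using eventually_ge_at_top [of "max K 1 powr (1 / \<delta>)"]
proof eventually_elim
  case (elim x)
  have "K \<le> (max K 1 powr (1 / \<delta>)) powr \<delta>" using assms by (simp add: powr_powr)
  also have "\<dots> \<le> x powr \<delta>" using elim assms by (intro powr_mono2) auto
  finally show ?case .
qed

text \<open>On the scale \<open>x = ln n\<close> the step reads \<open>F (C k y) \<ge> min (k F y) y\<close>; with
  \<open>y = x\<^bsup>1-\<delta>\<^esup>\<close> and \<open>k = x\<^bsup>\<delta>\<^esup> / C\<close> it improves an exponent \<open>\<alpha>\<close> to \<open>\<delta> + (1 - \<delta>) \<alpha>\<close>.\<close>

lemma growth_from_product_step: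
  fixes H :: "real \<Rightarrow> real \<Rightarrow> bool" and C :: nat
  assumes mono: "\<And>x m x' m'. H x m \<Longrightarrow> x \<le> x' \<Longrightarrow> m' \<le> m \<Longrightarrow> H x' m'"
    and H1: "H 1 1" and H2: "H 2 2"
    and step: "\<And>(t::nat) a x b. 2 \<le> t \<Longrightarrow> H (real t) a \<Longrightarrow> H x b \<Longrightarrow> 1 \<le> x \<Longrightarrow> 0 \<le> a \<Longrightarrow> 1 \<le> b \<Longrightarrow> b \<le> real t
        \<Longrightarrow> H (x * real t ^ C) (a * b)"
    and \<delta>: "0 < \<delta>" "\<delta> < 1"
  shows "\<exists>c>0. \<exists>x0. \<forall>x\<ge>x0. H (exp x) (exp (c * x powr (1 - \<delta>)))"
proof -
  \<comment> \<open>The step is repeated with the same \<open>t\<close>: each round multiplies the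
    cograph by \<open>a\<close>, until the side condition \<open>b \<le> t\<close> caps it at
    \<open>t\<close>.\<close>
  have iter: "H (real t ^ (C * k)) (min (a ^ k) t)" if t: "t \<ge> 2" and a: "H t a" "a \<ge> 1" for t k :: nat and a
  proof (induction k)
    case 0
    show ?case using t H1 by simp
  next
    case (Suc k)
    have "H (real t ^ (C * k) * real t ^ C) (a * min (a ^ k) t)"
      using t a by (intro step Suc) (auto simp: min_def one_le_power)
    moreover have "min (a ^ Suc k) t \<le> a * min (a ^ k) t"
    proof (cases "a ^ k \<le> t")
      case False
      have "1 * real t \<le> a * t" using a by (intro mult_right_mono) auto
      then show ?thesis using False by (simp add: min_def)
    qed simp
    moreover have "real t ^ (C * k) * real t ^ C = real t ^ (C * Suc k)" by (simp add: power_add)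
    ultimately show ?case using mono by (metis order_refl)
  qed
  have improve: "\<exists>c>0. \<exists>x0. \<forall>x\<ge>x0. H (exp x) (exp (c * x powr min (1 - \<delta>) (\<delta> + (1 - \<delta>) * \<alpha>)))"
    if c: "c > 0" and x0: "\<And>x. x \<ge> x0 \<Longrightarrow> H (exp x) (exp (c * x powr \<alpha>))" and \<alpha>: "0 \<le> \<alpha>" for c x0 \<alpha>
  proof -
    \<comment> \<open>The added 1 keeps the divisor of \<open>x powr \<delta>\<close> positive when
      \<open>C = 0\<close>.\<close>
    define C' where "C' = real C + 1"
    have C': "C' \<ge> 1" by (simp add: C'_def)
    \<comment> \<open>One entry for each argument of the minimum in \<open>iter\<close>:
      \<open>1 / 2\<close> comes from \<open>exp (y / 2) \<le> t\<close>, the other from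
      \<open>k \<ge> x powr \<delta> / (2 * C')\<close> and
      \<open>ln a = c * (y / 2) powr \<alpha>\<close>.\<close>
    define c' where "c' = min (1 / 2) (c / (2 * C') * (1 / 2) powr \<alpha>)"
    have c': "c' > 0" using c C' by (simp add: c'_def)
    have "\<forall>\<^sub>F x in at_top. x powr (1 - \<delta>) \<ge> max 2 (2 * \<bar>x0\<bar>)"
      using \<delta> by (intro eventually_powr_ge) auto
    moreover have "\<forall>\<^sub>F x in at_top. x powr \<delta> \<ge> 2 * C'"
      using \<delta> by (intro eventually_powr_ge) auto
    moreover have "\<forall>\<^sub>F x in at_top. (x::real) \<ge> 1" by (rule eventually_ge_at_top)
    ultimately have "\<forall>\<^sub>F x in at_top. H (exp x) (exp (c' * x powr min (1 - \<delta>) (\<delta> + (1 - \<delta>) * \<alpha>)))"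
    proof eventually_elim
      case (elim x)
      define y where "y = x powr (1 - \<delta>)"
      define t where "t = nat \<lfloor>exp y\<rfloor>"
      define k where "k = nat \<lfloor>x powr \<delta> / C'\<rfloor>"
      have y: "y \<ge> 2" "y / 2 \<ge> x0" using elim by (auto simp: y_def)
      have t_le: "real t \<le> exp y" by (simp add: t_def)
      have two: "exp (y / 2) \<ge> 2" using y exp_ge_add_one_self [of "y / 2"] by linarith
      have "2 * exp (y / 2) \<le> exp (y / 2) * exp (y / 2)" using two by (intro mult_right_mono) auto
      also have "\<dots> = exp y" by (simp flip: exp_add)
      finally have "exp (y / 2) \<le> exp y - 1" using two by linarith
      also have "\<dots> \<le> t" unfolding t_def by linarith
      finally have t_ge: "exp (y / 2) \<le> t" .
      have t2: "t \<ge> 2" using t_ge two by linarith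
      define a where "a = exp (c * (y / 2) powr \<alpha>)"
      have a1: "a \<ge> 1" using c by (simp add: a_def)
      have Ha: "H t a" unfolding a_def by (rule mono [OF x0]) (use y t_ge in auto)
      have z2: "x powr \<delta> / C' \<ge> 2" using elim C' by (simp add: field_simps)
      have k_le: "real k \<le> x powr \<delta> / C'" using z2 by (simp add: k_def)
      have k_ge: "x powr \<delta> / (2 * C') \<le> real k"
      proof -
        have half: "z / 2 \<le> nat \<lfloor>z\<rfloor>" if "z \<ge> 2" for z :: real using that by linarith
        show ?thesis using half [OF z2] by (simp add: k_def mult.commute)
      qed
      have Ht: "H (real t ^ (C * k)) (min (a ^ k) t)" by (rule iter [OF t2 Ha a1])
      have "real t ^ (C * k) \<le> exp y ^ (C * k)" using t_le by (intro power_mono) auto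
      also have "\<dots> = exp (C * k * y)" by (simp flip: exp_of_nat_mult)
      also have "\<dots> \<le> exp x"
      proof -
        have "real C * k * y \<le> C' * (x powr \<delta> / C') * y"
          using k_le y C' by (intro mult_right_mono mult_mono) (auto simp: C'_def)
        also have "\<dots> = x powr \<delta> * y" using C' by simp
        also have "\<dots> = x" using elim by (simp add: y_def flip: powr_add)
        finally show ?thesis by simp
      qed
      finally have *: "real t ^ (C * k) \<le> exp x" .
      have le1: "exp (c' * x powr min (1 - \<delta>) (\<delta> + (1 - \<delta>) * \<alpha>)) \<le> t"
      proof -
        have "c' * x powr min (1 - \<delta>) (\<delta> + (1 - \<delta>) * \<alpha>) \<le> (1 / 2) * x powr (1 - \<delta>)"
          using elim c' by (intro mult_mono powr_mono) (auto simp: c'_def)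
        also have "\<dots> = y / 2" by (simp add: y_def)
        finally show ?thesis using t_ge order_trans exp_le_cancel_iff by blast
      qed
      have le2: "exp (c' * x powr min (1 - \<delta>) (\<delta> + (1 - \<delta>) * \<alpha>)) \<le> a ^ k"
      proof -
        have "c' * x powr min (1 - \<delta>) (\<delta> + (1 - \<delta>) * \<alpha>)
            \<le> c / (2 * C') * (1 / 2) powr \<alpha> * x powr (\<delta> + (1 - \<delta>) * \<alpha>)"
          using elim c' c C' by (intro mult_mono powr_mono) (auto simp: c'_def)
        also have "\<dots> = (x powr \<delta> / (2 * C')) * (c * (y / 2) powr \<alpha>)"
          using y by (simp add: y_def powr_add powr_powr powr_divide)
        also have "\<dots> \<le> k * (c * (y / 2) powr \<alpha>)"
          using k_ge c by (intro mult_right_mono) auto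
        finally show ?thesis by (simp add: a_def flip: exp_of_nat_mult)
      qed
      show ?case by (rule mono [OF Ht *]) (use le1 le2 in auto)
    qed
    then show ?thesis using c' unfolding eventually_at_top_linorder by blast
  qed
  \<comment> \<open>While \<open>\<alpha> \<le> 1 - \<delta>\<close>, a round raises the exponent by
    \<open>\<delta> * (1 - \<alpha>) \<ge> \<delta>\<^sup>2\<close>, up to the cap
    \<open>1 - \<delta>\<close>. Finitely many rounds suffice, so the constant \<open>c\<close>,
    which may shrink in each of them, stays positive. The start has exponent 0, where the claim is
    just a cograph on two vertices.\<close>
  define \<alpha> where "\<alpha> j = min (1 - \<delta>) (real j * \<delta>\<^sup>2)" for j
  have "\<exists>c>0. \<exists>x0. \<forall>x\<ge>x0. H (exp x) (exp (c * x powr \<alpha> j))" for j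
  proof (induction j)
    case 0
    have "H (exp x) (exp (ln 2 * x powr \<alpha> 0))" if "x \<ge> ln 2" for x
    proof -
      have "x > 0" using that ln_gt_zero [of "2::real"] by linarith
      then show ?thesis using that \<delta> exp_le_cancel_iff [of "ln 2" x]
        by (intro mono [OF H2]) (auto simp: \<alpha>_def min_def)
    qed
    then show ?case using ln_gt_zero [of "2::real"] by (intro exI [of _ "ln 2"]) auto
  next
    case (Suc j)
    then obtain c x0 where c: "c > 0" and x0: "\<And>x. x \<ge> x0 \<Longrightarrow> H (exp x) (exp (c * x powr \<alpha> j))"
      by blast
    have \<alpha>0: "0 \<le> \<alpha> j" "\<alpha> j \<le> 1 - \<delta>" using \<delta> by (auto simp: \<alpha>_def)
    obtain c' x1 where c': "c' > 0"
      and x1: "\<And>x. x \<ge> x1 \<Longrightarrow> H (exp x) (exp (c' * x powr min (1 - \<delta>) (\<delta> + (1 - \<delta>) * \<alpha> j)))"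
      using improve [OF c x0 \<alpha>0(1)] by blast
    have "\<delta> * \<alpha> j \<le> \<delta> * (1 - \<delta>)" using \<delta> \<alpha>0 by (intro mult_left_mono) auto
    then have "\<alpha> j + \<delta>\<^sup>2 \<le> \<delta> + (1 - \<delta>) * \<alpha> j" by (simp add: algebra_simps power2_eq_square)
    moreover have "\<alpha> (Suc j) \<le> min (1 - \<delta>) (\<alpha> j + \<delta>\<^sup>2)"
      by (auto simp: \<alpha>_def min_def algebra_simps)
    ultimately have le: "\<alpha> (Suc j) \<le> min (1 - \<delta>) (\<delta> + (1 - \<delta>) * \<alpha> j)" by linarith
    have "H (exp x) (exp (c' * x powr \<alpha> (Suc j)))" if "x \<ge> max 1 x1" for x
      by (rule mono [OF x1]) (use that c' le in \<open>auto intro!: mult_left_mono powr_mono\<close>)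
    then show ?case using c' by blast
  qed
  moreover obtain j where "real j * \<delta>\<^sup>2 \<ge> 1"
    using reals_Archimedean3 [of "\<delta>\<^sup>2"] \<delta> by (metis less_imp_le zero_less_power)
  then have "\<alpha> j = 1 - \<delta>" using \<delta> by (simp add: \<alpha>_def)
  ultimately show ?thesis by metis
qed

section \<open>From cographs to cliques and independent sets of set-based graphs\<close>

theorem theorem1:
  fixes d :: nat
  assumes "d > 0"
  shows "\<exists>\<epsilon> :: nat \<Rightarrow> real. \<epsilon> \<longlonglongrightarrow> 0 \<and>
    (\<forall>n \<ge> 1. \<forall>(V :: 'a set) E.
      simple_graph V E \<and> card V = n \<and> graph_VC_dim V E \<le> d \<longrightarrow>
      (\<exists>X\<subseteq>V. (clique X E \<or> indep X E) \<and>
        real (card X) \<ge> exp (ln (real n) powr (1 - \<epsilon> n))))"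
proof (rule diagonal_null_sequence)
  let ?H = "cograph_bound (vc_graphs d :: 'a rel_graph set)"
  have adj: "({u, v} \<in> E) = ({v, u} \<in> E)" for u v :: 'a and E by (simp add: insert_commute)
  have in_vc: "((\<lambda>u v. {u, v} \<in> E), V) \<in> vc_graphs d"
    if "simple_graph V E" "graph_VC_dim V E \<le> d" for V :: "'a set" and E
  proof -
    have fin: "finite V" using that by (simp add: simple_graph_def)
    have "card S \<le> d" if S: "S \<subseteq> V" "shatters (neighbours V E ` V) S" for S
    proof -
      \<comment> \<open>Finiteness of \<open>V\<close> bounds the sizes of shattered sets, so the
        greatest element exists.\<close>
      have "card S \<le> VC_dim V (neighbours V E ` V)"
        unfolding VC_dim_def
      proof (rule Greatest_le_nat)
        show "\<exists>S'\<subseteq>V. finite S' \<and> card S' = card S \<and> shatters (neighbours V E ` V) S'"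
          using S fin finite_subset by blast
        show "k \<le> card V" if "\<exists>S'\<subseteq>V. finite S' \<and> card S' = k \<and> shatters (neighbours V E ` V) S'" for k
          using that fin card_mono by blast
      qed
      then show ?thesis using \<open>graph_VC_dim V E \<le> d\<close> by (simp add: graph_VC_dim_def)
    qed
    then show ?thesis
      using fin adj by (auto simp: vc_graphs_def vc_le_def neighbours_def [abs_def] intro: sympI)
  qed
  have H_mono: "?H x' m'" if H: "?H x m" and le: "x \<le> x'" "m' \<le> m" for x m x' m'
    unfolding cograph_bound_def
  proof (intro allI impI)
    fix A V assume "(A, V) \<in> (vc_graphs d :: 'a rel_graph set)" "x' \<le> card V"
    then obtain X where "X \<subseteq> V" "cograph A X" "m \<le> card X"
      using H le(1) unfolding cograph_bound_def by (meson order_trans)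
    then show "\<exists>X\<subseteq>V. cograph A X \<and> m' \<le> card X" using le(2) by (meson order_trans)
  qed
  have H1: "?H 1 1"
    unfolding cograph_bound_def
  proof (intro allI impI)
    fix A :: "'a \<Rightarrow> 'a \<Rightarrow> bool" and V :: "'a set" assume "1 \<le> real (card V)"
    then obtain v where "v \<in> V" by (metis card.empty equals0I not_one_le_zero of_nat_0)
    then show "\<exists>X\<subseteq>V. cograph A X \<and> 1 \<le> real (card X)"
      by (intro exI [of _ "{v}"]) (simp add: cograph.singleton)
  qed
  have H2: "?H 2 2"
    unfolding cograph_bound_def
  proof (intro allI impI)
    fix A :: "'a \<Rightarrow> 'a \<Rightarrow> bool" and V :: "'a set" assume "2 \<le> real (card V)"
    then have "2 \<le> card V" by simp
    then obtain S where "S \<subseteq> V" "card S = 2" by (meson obtain_subset_with_card_n)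
    moreover from this obtain u v where "S = {u, v}" "u \<noteq> v" by (meson card_2_iff)
    moreover have "cograph A ({u} \<union> {v})"
      by (rule cograph.union [where b = "A u v"]) (use \<open>u \<noteq> v\<close> in \<open>auto intro: cograph.singleton\<close>)
    ultimately show "\<exists>X\<subseteq>V. cograph A X \<and> 2 \<le> real (card X)"
      by (intro exI [of _ S]) (simp add: insert_commute)
  qed
  show "\<forall>\<^sub>F n in sequentially. \<forall>(V :: 'a set) E.
      simple_graph V E \<and> card V = n \<and> graph_VC_dim V E \<le> d \<longrightarrow>
      (\<exists>X\<subseteq>V. (clique X E \<or> indep X E) \<and> real (card X) \<ge> exp (ln (real n) powr (1 - \<delta>)))"
    if "\<delta> > 0" for \<delta> :: real
  proof -
    \<comment> \<open>Halving leaves a spare factor \<open>x powr \<delta>'\<close>, since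
      \<open>\<delta>' + (1 - \<delta>) \<le> 1 - \<delta>'\<close>. It pays for the constant
      \<open>c\<close> and for the 2 that comes from the square root.\<close>
    define \<delta>' where "\<delta>' = min \<delta> 1 / 2"
    have \<delta>': "0 < \<delta>'" "\<delta>' < 1" "\<delta>' \<le> \<delta> / 2" using that by (auto simp: \<delta>'_def)
    obtain C :: nat where step: "\<And>(t::nat) a x b. 2 \<le> t \<Longrightarrow> ?H (real t) a \<Longrightarrow> ?H x b \<Longrightarrow> 1 \<le> x \<Longrightarrow> 0 \<le> a \<Longrightarrow>
        1 \<le> b \<Longrightarrow> b \<le> real t \<Longrightarrow> ?H (x * real t ^ C) (a * b)"
      using cograph_bound_step [OF assms] by metis
    have "\<exists>c>0. \<exists>x0. \<forall>x\<ge>x0. ?H (exp x) (exp (c * x powr (1 - \<delta>')))"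
      by (rule growth_from_product_step [where C = C]) (fact H_mono H1 H2 step \<delta>')+
    then obtain c x0 where c: "c > 0"
      and H: "\<And>x. x \<ge> x0 \<Longrightarrow> ?H (exp x) (exp (c * x powr (1 - \<delta>')))" by blast
    have "\<forall>\<^sub>F x in at_top. x \<ge> x0 \<and> x \<ge> 1 \<and> 2 / c \<le> x powr \<delta>'"
      by (intro eventually_conj eventually_ge_at_top eventually_powr_ge \<delta>')
    then have "\<forall>\<^sub>F n in sequentially. ln (real n) \<ge> x0 \<and> ln (real n) \<ge> 1 \<and> 2 / c \<le> ln (real n) powr \<delta>'"
      by (rule eventually_compose_filterlim)
        (rule filterlim_compose [OF ln_at_top filterlim_real_sequentially])
    then show ?thesis
      using eventually_gt_at_top [of 0]
    proof eventually_elim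
      case (elim n)
      define x where "x = ln (real n)"
      have x: "x \<ge> x0" "x \<ge> 1" "2 / c \<le> x powr \<delta>'" and n: "real n = exp x"
        using elim by (auto simp: x_def)
      have "2 * x powr (1 - \<delta>) \<le> c * x powr \<delta>' * x powr (1 - \<delta>)"
        using x c by (intro mult_right_mono) (auto simp: field_simps)
      also have "\<dots> = c * x powr (\<delta>' + (1 - \<delta>))" by (simp add: powr_add)
      also have "\<dots> \<le> c * x powr (1 - \<delta>')"
        using x c \<delta>' by (intro mult_left_mono powr_mono) auto
      finally have le: "2 * x powr (1 - \<delta>) \<le> c * x powr (1 - \<delta>')" .
      show ?case
      proof (intro allI impI, elim conjE)
        fix V :: "'a set" and E
        assume G: "simple_graph V E" "card V = n" "graph_VC_dim V E \<le> d"
        let ?A = "\<lambda>u v. {u, v} \<in> E"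
        have "exp x \<le> card V" using G n by simp
        then obtain U where U: "U \<subseteq> V" "cograph ?A U" "exp (c * x powr (1 - \<delta>')) \<le> card U"
          using H [OF x(1)] in_vc [OF G(1,3)] unfolding cograph_bound_def by metis
        have "symp ?A" using adj by (auto intro: sympI)
        from cograph_homogeneous_product [OF U(2) this]
        obtain X Y where X: "X \<subseteq> U" "clique X E" and Y: "Y \<subseteq> U" "indep Y E"
          and XY: "card U \<le> card X * card Y" unfolding clique_def indep_def by blast
        define z where "z = exp (x powr (1 - \<delta>))"
        have "z * z = exp (2 * x powr (1 - \<delta>))" by (simp add: z_def flip: exp_add)
        also have "\<dots> \<le> card U" using U(3) le by (meson exp_le_cancel_iff order_trans)
        also have "\<dots> \<le> real (card X) * card Y" using XY by (metis of_nat_le_iff of_nat_mult)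
        finally have zz: "z * z \<le> real (card X) * card Y" .
        have "z \<le> card X \<or> z \<le> card Y"
        proof (rule ccontr)
          assume "\<not> ?thesis"
          then have "real (card X) * card Y < z * z" by (intro mult_strict_mono) (auto simp: z_def)
          then show False using zz by simp
        qed
        then show "\<exists>X\<subseteq>V. (clique X E \<or> indep X E) \<and> exp (ln (real n) powr (1 - \<delta>)) \<le> real (card X)"
          unfolding z_def x_def using X Y U(1) by (meson order_trans)
      qed
    qed
  qed
  show "\<exists>\<delta>. \<forall>(V :: 'a set) E.
      simple_graph V E \<and> card V = n \<and> graph_VC_dim V E \<le> d \<longrightarrow>
      (\<exists>X\<subseteq>V. (clique X E \<or> indep X E) \<and> real (card X) \<ge> exp (ln (real n) powr (1 - \<delta>)))"
    if "n \<ge> 1" for n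
  proof -
    \<comment> \<open>Small \<open>n\<close> need a value as well, and any \<open>min n 2\<close>
      vertices form a clique or an independent set. For \<open>n \<le> 2\<close> the value 0 works,
      with \<open>0 powr 1 = 0\<close> when \<open>n = 1\<close>. For larger \<open>n\<close> the
      base \<open>ln n\<close> exceeds 1, so a suitable exponent brings the power to exactly
      \<open>ln 2\<close>.\<close>
    have "\<exists>\<delta>. exp (ln (real n) powr (1 - \<delta>)) \<le> min n 2"
    proof (cases "n \<le> 2")
      case True
      then show ?thesis using that by (intro exI [of _ 0]) (auto simp: min_def)
    next
      case False
      have "ln (real n) > 1"
      proof -
        \<comment> \<open>Shows \<open>exp 1 < 3\<close>, as \<open>(5 / 6) ^ 6\<close> is slightly
          more than \<open>1 / 3\<close>.\<close>
        have "(5 / 6 :: real) ^ 6 \<le> exp (- 1 / 6) ^ 6"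
          using exp_ge_add_one_self [of "- 1 / 6"] by (intro power_mono) auto
        also have "exp (- 1 / 6 :: real) ^ 6 = exp (- 1)" by (simp flip: exp_of_nat_mult)
        finally have "1 / 3 < exp (- 1 :: real)" by (simp add: power_divide)
        then have "exp 1 < (3 :: real)" by (simp add: exp_minus field_simps)
        then have "exp 1 < real n" using False by simp
        then show ?thesis using False ln_less_cancel_iff [of "exp 1" "real n"] by simp
      qed
      then have "ln (real n) powr (1 - (1 - log (ln (real n)) (ln 2))) = ln 2" by simp
      then have "exp (ln (real n) powr (1 - (1 - log (ln (real n)) (ln 2)))) = 2" by (simp only: exp_ln zero_less_numeral)
      then show ?thesis using False by (metis less_le_not_le min.absorb2 nle_le of_nat_numeral order_refl)
    qed
    then obtain \<delta> where \<delta>: "exp (ln (real n) powr (1 - \<delta>)) \<le> min n 2" by blast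
    have "\<exists>X\<subseteq>V. (clique X E \<or> indep X E) \<and> real (card X) \<ge> exp (ln (real n) powr (1 - \<delta>))"
      if V: "card V = n" for V :: "'a set" and E
    proof -
      obtain X where X: "X \<subseteq> V" "card X = min n 2"
        using obtain_subset_with_card_n [of "min n 2" V] V by auto
      have "card X = 1 \<or> card X = 2" using X \<open>n \<ge> 1\<close> by (auto simp: min_def)
      then have "\<exists>u v. X = {u, v}" by (auto simp: card_1_singleton_iff card_2_iff)
      then have "clique X E \<or> indep X E" using adj by (auto simp: clique_def indep_def)
      then show ?thesis using X \<delta> by (intro exI [of _ X]) simp
    qed
    then show ?thesis by blast
  qed
qed

end
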